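(* Let $s\in\mathbb{R}$ and let $p\in\{0,1,2,\ldots\}$ be such that $s+2p>0$. Let $$S_k(s)=\sum_{j=1}^{k-1}(1-e^{2\pi i j/k})^{-s}.$$ Then, as $k\to\infty$ through the positive integers, $$S_k(s)=k+2\sum_{l=0}^{2p}\beta_l(s)\,\zeta(s-l)\,k^{s-l}+O_{s,p}(k^{s-2p-1})\qquad\text{if } s\neq 1,2,\ldots,$$ and $$S_k(s)=\tfrac12 k+2\sum_{\substack{l=0\\ l\neq s-1}}^{2p}\beta_l(s)\,\zeta(s-l)\,k^{s-l}+O_{s,p}(k^{s-2p-1})\qquad\text{if } s=1,2,\ldots,$$ where the constants implied by $O_{s,p}$ depend on $s$ and $p$ but not on $k$.
   Context: Complex powers $(1-e^{2\pi i j/k})^{-s}$ are principal values (the base has positive real part for $1\le j\le k-1$). $\zeta$ denotes the Riemann zeta function (analytically continued). The numbers $B_l^{(s)}(0)$ (values at $0$ of generalized Bernoulli polynomials) are defined by $$\Bigl(\frac{z}{e^z-1}\Bigr)^s=\sum_{l=0}^{\infty}\frac{B_l^{(s)}(0)}{l!}z^l,\qquad |z|<2\pi,$$ where the branch of the left-hand side is the one equal to $1$ at $z=0$. The coefficients $\beta_l(s)$ are $$\beta_l(s)=\frac{(2\pi)^{l-s}B_l^{(s)}(0)}{l!}\cos\Bigl((l+s)\frac{\pi}{2}\Bigr),\qquad l=0,1,2,\ldots.$$ *)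

theory Defs
  imports
    "HOL-Complex_Analysis.Complex_Analysis"
    "HOL-Library.Landau_Symbols"
begin

(* The two conditions determine f on the connected set - {1}, by the identity theorem.
   The value zeta 1 is left unspecified. *)
definition zeta :: "complex \<Rightarrow> complex" where
  "zeta = (SOME f. f holomorphic_on (- {1}) \<and>
     (\<forall>s. Re s > 1 \<longrightarrow> (\<lambda>n. of_nat (Suc n) powr (- s)) sums f s))"

(* The branch on |z| < 2 pi of log (z / (exp z - 1)) that vanishes at 0. At z = 0 itself
   HOL's convention 0 / 0 = 0 gives the wrong value, hence the punctured ball.
   The principal logarithm Ln is not used, as the branch is prescribed by its value at 0. *)
definition bern_log :: "complex \<Rightarrow> complex" where
  "bern_log = (SOME L. L holomorphic_on ball 0 (2 * pi) \<and> L 0 = 0 \<and>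
     (\<forall>z \<in> ball 0 (2 * pi) - {0}. exp (L z) = z / (exp z - 1)))"

definition gen_bernoulli :: "complex \<Rightarrow> nat \<Rightarrow> complex" where
  "gen_bernoulli s = (THE B. \<forall>z. norm z < 2 * pi \<longrightarrow>
     (\<lambda>l. B l / fact l * z ^ l) sums exp (s * bern_log z))"

definition beta_coeff :: "nat \<Rightarrow> real \<Rightarrow> complex" where
  "beta_coeff l s = of_real ((2 * pi) powr (real l - s)) * gen_bernoulli (of_real s) l / fact l
     * of_real (cos ((real l + s) * pi / 2))"

definition S_sum :: "nat \<Rightarrow> real \<Rightarrow> complex" where
  "S_sum k s = (\<Sum>j = 1..<k.
     (1 - exp (2 * of_real pi * \<i> * of_nat j / of_nat k)) powr (- of_real s))"

(* The choice in bern_log and the description in gen_bernoulli are not vacuous: *)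

lemma bern_log_props:
  "bern_log holomorphic_on ball 0 (2 * pi)"
  "bern_log 0 = 0"
  "z \<in> ball 0 (2 * pi) - {0} \<Longrightarrow> exp (bern_log z) = z / (exp z - 1)"
proof -
  let ?B = "ball 0 (2 * pi) :: complex set"
  define f where "f = (\<lambda>z::complex. if z = 0 then 1 else (exp z - 1) / z)"
  have nz: "exp z \<noteq> 1" if "z \<in> ?B" "z \<noteq> 0" for z :: complex
  proof
    assume "exp z = 1"
    then obtain n :: int where n: "Re z = 0" "Im z = of_int (2 * n) * pi"
      by (auto simp: exp_eq_1)
    with that(2) have "n \<noteq> 0" by (auto simp: complex_eq_iff)
    hence "1 \<le> \<bar>real_of_int n\<bar>" by linarith
    hence "2 * pi \<le> \<bar>Im z\<bar>" using n by (simp add: abs_mult)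
    also have "\<dots> \<le> norm z" by (rule abs_Im_le_cmod)
    finally show False using that(1) by simp
  qed
  have "f holomorphic_on ?B"
  proof (rule pole_theorem_0[where g = "\<lambda>z. exp z - 1" and a = 0])
    show "f 0 = deriv (\<lambda>z. exp z - 1) 0"
    proof -
      have "((\<lambda>z::complex. exp z - 1) has_field_derivative 1) (at 0)"
        by (auto intro!: derivative_eq_intros)
      thus ?thesis by (simp add: f_def DERIV_imp_deriv)
    qed
  qed (auto intro!: holomorphic_intros simp: f_def interior_open)
  moreover have f0: "f z \<noteq> 0" if "z \<in> ?B" for z
    using nz[OF that] by (auto simp: f_def)
  ultimately obtain g where g: "g holomorphic_on ?B" "\<And>z. z \<in> ?B \<Longrightarrow> f z = exp (g z)"
    using simply_connected_eq_holomorphic_log[of ?B] convex_imp_simply_connected[of ?B] by auto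
  have g0: "exp (g 0) = 1" using g(2)[of 0] by (simp add: f_def)
  have "\<exists>L. L holomorphic_on ?B \<and> L 0 = 0 \<and> (\<forall>z \<in> ?B - {0}. exp (L z) = z / (exp z - 1))"
  proof (intro exI[of _ "\<lambda>z. g 0 - g z"] conjI ballI)
    fix z assume z: "z \<in> ?B - {0}"
    have "exp (g 0 - g z) = 1 / f z" using g(2)[of z] g0 z by (simp add: exp_diff)
    thus "exp (g 0 - g z) = z / (exp z - 1)" using z by (simp add: f_def)
  qed (auto intro!: holomorphic_intros g)
  from someI_ex[OF this, folded bern_log_def]
  show "bern_log holomorphic_on ?B" "bern_log 0 = 0"
    "z \<in> ?B - {0} \<Longrightarrow> exp (bern_log z) = z / (exp z - 1)" by auto
qed

lemma gen_bernoulli_sums: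
  assumes "norm z < 2 * pi"
  shows "(\<lambda>l. gen_bernoulli s l / fact l * z ^ l) sums exp (s * bern_log z)"
proof -
  let ?F = "\<lambda>z. exp (s * bern_log z)"
  let ?P = "\<lambda>B. \<forall>z. norm z < 2 * pi \<longrightarrow> (\<lambda>l. B l / fact l * z ^ l) sums ?F z"
  have hol: "?F holomorphic_on ball 0 (2 * pi)"
    by (intro holomorphic_intros bern_log_props)
  have ex: "?P (\<lambda>l. (deriv ^^ l) ?F 0)"
    using holomorphic_power_series[OF hol] by auto
  have uniq: "B = C" if B: "?P B" and C: "?P C" for B C
  proof
    fix l
    have E: "?F has_fps_expansion Abs_fps (\<lambda>l. A l / fact l)" if A: "?P A" for A
    proof (rule has_fps_expansionI)
      have "eventually (\<lambda>z. z \<in> ball 0 (2 * pi)) (nhds (0::complex))"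
        by (rule eventually_nhds_in_open) auto
      thus "\<forall>\<^sub>F z in nhds 0. (\<lambda>n. fps_nth (Abs_fps (\<lambda>l. A l / fact l)) n * z ^ n) sums ?F z"
        by eventually_elim (use A in auto)
    qed
    have "Abs_fps (\<lambda>l. B l / fact l) = Abs_fps (\<lambda>l. C l / fact l)"
      using fps_expansion_eqI[OF E[OF B]] fps_expansion_eqI[OF E[OF C]] by simp
    hence "fps_nth (Abs_fps (\<lambda>l. B l / fact l)) l = fps_nth (Abs_fps (\<lambda>l. C l / fact l)) l"
      by (rule arg_cong)
    thus "B l = C l" by simp
  qed
  have "?P (gen_bernoulli s)"
    unfolding gen_bernoulli_def by (rule theI[of ?P, OF ex]) (rule uniq[OF _ ex])
  with assms show ?thesis by blast
qed

end

theory Submission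
  imports Defs "HOL-Real_Asymp.Real_Asymp"
begin

text \<open>
The sum is a Riemann sum of \<open>f x = (1 - exp (2 * pi * \<i> * x)) powr (-s)\<close> with step \<open>1 / k\<close>, and \<open>f\<close> has
algebraic singularities at the end points \<open>0\<close> and \<open>1\<close>. The proof compares the Riemann sum with the integral
by the Abel--Plana formula with half-integer end points (\<open>abel_plana_midpoint\<close>), and uses the very
same formula to continue the zeta function (\<open>zeta_abel_plana\<close>):
\<open>zeta a = (1 / 2) powr (1 - a) / (a - 1) + zeta_edge a\<close>, where \<open>zeta_edge a\<close> is an integral over the line \<open>Re y = 1 / 2\<close>
against an exponentially decaying kernel.

Near \<open>0\<close> one has \<open>f x = (\<Sum>l\<le>N. c l * x powr (l - s))\<close> up to an error of order \<open>N + 1 - s\<close>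
(\<open>root_power_expansion\<close>), with \<open>Re (c l) = beta_coeff l s\<close>; the behaviour at \<open>1\<close> is conjugate, as
\<open>f (1 - cnj x) = cnj (f x)\<close>. The Abel--Plana formula for \<open>f (y / k)\<close> has two ingredients.

 \<^item> The vertical edges. Inserting the expansion gives \<open>2 * beta_coeff l s * k powr (s - l) * zeta_edge (s - l)\<close>
   for each \<open>l\<close>, because \<open>x powr (l - s)\<close> scales to \<open>y powr (l - s)\<close>.

 \<^item> The integral of \<open>f\<close> from \<open>\<delta>\<close> to \<open>1 - \<delta>\<close>, where \<open>\<delta> = 1 / (2 * k)\<close>. As \<open>f\<close> is periodic and tends to
   \<open>1\<close> high up in the upper half-plane, its integral over a period there is \<open>1\<close>. Hence the integral is \<open>1\<close> minus
   twice the real part of the integral over the chord from \<open>\<i> * \<delta>\<close> to \<open>\<delta>\<close>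
   (\<open>root_power_integral\<close>). Termwise integration of the expansion on the chord yields exactly the
   missing part \<open>(1 / 2) powr (1 - a) / (a - 1)\<close> of \<open>zeta a\<close> for \<open>a = s - l\<close>.

The pole of \<open>zeta\<close> at \<open>a = 1\<close> is met only if \<open>s\<close> is a positive integer and \<open>l = s - 1\<close>. Then the term is a multiple of
\<open>1 / x\<close> with the imaginary coefficient \<open>\<i> / (2 * pi)\<close> (\<open>sing_coeff_residue\<close>). Its contribution to the
edges cancels with the conjugate one, and on the chord the logarithm turns by \<open>pi / 2\<close>, which
contributes \<open>1 / 2\<close> and so replaces \<open>k\<close> by \<open>k / 2\<close>.
\<close>

section \<open>A finite Abel--Plana formula\<close>

text \<open>
Up to sign, the difference between \<open>1 / (exp (2 * pi * \<i> * z) - 1)\<close> and its limit for \<open>\<bar>Im z\<bar> \<rightarrow> \<infinity>\<close>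
(\<open>-1\<close> above and \<open>0\<close> below the real axis), at distance \<open>t\<close> from the real axis on a vertical line
through a half-integer.
\<close>
definition ap_kernel :: "real \<Rightarrow> real" where
  "ap_kernel t = 1 / (exp (2 * pi * t) + 1)"

text \<open>
The correction term that a vertical edge at abscissa \<open>c\<close> contributes to the Abel--Plana formula.
\<close>
definition ap_edge :: "(complex \<Rightarrow> complex) \<Rightarrow> real \<Rightarrow> real \<Rightarrow> complex" where
  "ap_edge g c T = \<i> * integral {0..T}
     (\<lambda>t. of_real (ap_kernel t) * (g (Complex c (-t)) - g (Complex c t)))"

lemma continuous_on_ap_kernel [continuous_intros]:
  "continuous_on A f \<Longrightarrow> continuous_on A (\<lambda>t. ap_kernel (f t))"
  unfolding ap_kernel_def
  by (intro continuous_intros) (auto simp: add_pos_pos less_imp_neq[symmetric])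

lemma exp_2pi_i_Complex:
  "exp (2 * of_real pi * \<i> * Complex x y)
     = of_real (exp (- 2 * pi * y)) * exp (2 * of_real pi * \<i> * of_real x)"
  by (simp add: Complex_eq algebra_simps exp_of_real[symmetric] flip: exp_add)

lemma exp_2pi_i_half:
  assumes "c = real m - 1 / 2"
  shows "exp (2 * of_real pi * \<i> * complex_of_real c) = -1"
proof -
  have "2 * of_real pi * \<i> * complex_of_real c = of_nat m * (2 * of_real pi * \<i>) - of_real pi * \<i>"
    by (simp add: assms algebra_simps)
  also have "exp \<dots> = exp (2 * of_real pi * \<i>) ^ m / exp (of_real pi * \<i>)"
    by (simp add: exp_diff exp_of_nat_mult)
  finally show ?thesis by simp
qed

text \<open>
On a line through a half-integer the factor \<open>exp (2 * pi * \<i> * z)\<close> is the negative real number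
\<open>- exp (- 2 * pi * t)\<close>. Below the real axis the kernel \<open>1 / (exp (2 * pi * \<i> * z) - 1)\<close> is therefore \<open>-ap_kernel\<close>,
above it is \<open>-1 + ap_kernel\<close>; the \<open>-1\<close> yields the integral of \<open>g\<close> along the upper half of the edge.
\<close>
lemma ap_vertical_edge:
  assumes cont: "continuous_on {z. Re z = c} g" and c: "c = real m - 1 / 2" and T: "T > 0"
  shows "contour_integral (linepath (Complex c (-T)) (Complex c T))
            (\<lambda>z. g z / (exp (2 * of_real pi * \<i> * z) - 1))
       = - ap_edge g c T - contour_integral (linepath (Complex c 0) (Complex c T)) g"
proof -
  have contg: "continuous_on A (\<lambda>t. g (Complex c (h t)))" if "continuous_on A h" for A :: "real set" and h
    by (rule continuous_on_compose2[OF cont]) (use that in \<open>auto simp: Complex_eq intro!: continuous_intros\<close>)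
  let ?Q = "\<lambda>z. g z / (exp (2 * of_real pi * \<i> * z) - 1)"
  define q where "q = (\<lambda>t. - g (Complex c t) * of_real (ap_kernel (-t)))"
  have Q: "?Q (Complex c t) = q t" for t
  proof -
    have "exp (2 * of_real pi * \<i> * Complex c t) - 1 = - of_real (exp (2 * pi * (-t)) + 1)"
      by (simp add: exp_2pi_i_Complex exp_2pi_i_half[OF c])
    hence "?Q (Complex c t) = g (Complex c t) / - of_real (exp (2 * pi * (-t)) + 1)" by simp
    thus ?thesis by (simp only: q_def ap_kernel_def divide_minus_right of_real_divide of_real_1 times_divide_eq_right mult_1_right minus_divide_left)
  qed
  have split: "q t = - g (Complex c t) + g (Complex c t) * of_real (ap_kernel t)" for t
  proof -
    have "ap_kernel (-t) = 1 - ap_kernel t"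
      by (simp add: ap_kernel_def exp_minus divide_simps) (simp add: add_pos_pos less_imp_neq[symmetric])
    hence "complex_of_real (ap_kernel (-t)) = 1 - of_real (ap_kernel t)" by simp
    thus ?thesis unfolding q_def by (simp only:) (simp add: algebra_simps)
  qed
  have contq: "continuous_on A q" for A
    unfolding q_def by (intro continuous_intros contg)
  have "contour_integral (linepath (Complex c (-T)) (Complex c T)) ?Q
      = \<i> * integral {-T..T} (\<lambda>t. ?Q (Complex c t))"
    using T by (intro contour_integral_linepath_same_Re) auto
  also have "\<dots> = \<i> * integral {-T..T} q" by (simp only: Q)
  also have "integral {-T..T} q = integral {-T..0} q + integral {0..T} q"
    using T by (subst Henstock_Kurzweil_Integration.integral_combine[where c = 0])
       (auto intro!: integrable_continuous_interval contq)
  also have "integral {-T..0} q = integral {0..T} (\<lambda>t. q (-t))"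
    using Henstock_Kurzweil_Integration.integral_reflect_real[of T 0 "\<lambda>t. q (-t)"] by simp
  also have "(\<lambda>t. q (-t)) = (\<lambda>t. - g (Complex c (-t)) * of_real (ap_kernel t))"
    by (simp add: q_def)
  also have "integral {0..T} q = - integral {0..T} (\<lambda>t. g (Complex c t))
      + integral {0..T} (\<lambda>t. g (Complex c t) * of_real (ap_kernel t))"
    unfolding split
    by (subst Henstock_Kurzweil_Integration.integral_add)
       (auto intro!: integrable_continuous_interval continuous_intros contg)
  also have "\<i> * (integral {0..T} (\<lambda>t. - g (Complex c (-t)) * of_real (ap_kernel t)) + (- integral {0..T} (\<lambda>t. g (Complex c t))
      + integral {0..T} (\<lambda>t. g (Complex c t) * of_real (ap_kernel t))))
     = - ap_edge g c T - \<i> * integral {0..T} (\<lambda>t. g (Complex c t))"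
  proof -
    have "integral {0..T} (\<lambda>t. of_real (ap_kernel t) * (g (Complex c (-t)) - g (Complex c t)))
      = integral {0..T} (\<lambda>t. g (Complex c (-t)) * of_real (ap_kernel t))
        - integral {0..T} (\<lambda>t. g (Complex c t) * of_real (ap_kernel t))"
      by (subst Henstock_Kurzweil_Integration.integral_diff[symmetric])
         (auto intro!: integrable_continuous_interval continuous_intros contg simp: algebra_simps)
    thus ?thesis unfolding ap_edge_def by (simp only:) (simp add: algebra_simps)
  qed
  also have "\<i> * integral {0..T} (\<lambda>t. g (Complex c t)) = contour_integral (linepath (Complex c 0) (Complex c T)) g"
    using T by (intro contour_integral_linepath_same_Re[symmetric]) auto
  finally show ?thesis .
qed

lemma contour_integral_rectpath_split:
  assumes "continuous_on (path_image (rectpath (Complex a c) (Complex b d))) h" "a \<le> b" "c \<le> d"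
  shows "contour_integral (rectpath (Complex a c) (Complex b d)) h
     = contour_integral (linepath (Complex a c) (Complex b c)) h
     + contour_integral (linepath (Complex b c) (Complex b d)) h
     + contour_integral (linepath (Complex b d) (Complex a d)) h
     - contour_integral (linepath (Complex a c) (Complex a d)) h"
proof -
  have sub: "closed_segment (Complex a c) (Complex b c) \<subseteq> path_image (rectpath (Complex a c) (Complex b d))"
    "closed_segment (Complex b c) (Complex b d) \<subseteq> path_image (rectpath (Complex a c) (Complex b d))"
    "closed_segment (Complex b d) (Complex a d) \<subseteq> path_image (rectpath (Complex a c) (Complex b d))"
    "closed_segment (Complex a d) (Complex a c) \<subseteq> path_image (rectpath (Complex a c) (Complex b d))"
    by (auto simp: rectpath_def Let_def path_image_join)
  note c = contour_integrable_continuous_linepath[OF continuous_on_subset[OF assms(1) sub(1)]]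
    contour_integrable_continuous_linepath[OF continuous_on_subset[OF assms(1) sub(2)]]
    contour_integrable_continuous_linepath[OF continuous_on_subset[OF assms(1) sub(3)]]
    contour_integrable_continuous_linepath[OF continuous_on_subset[OF assms(1) sub(4)]]
  have "contour_integral (linepath (Complex a d) (Complex a c)) h
    = - contour_integral (linepath (Complex a c) (Complex a d)) h"
    by (subst contour_integral_reversepath[symmetric]) auto
  thus ?thesis using c by (simp add: rectpath_def Let_def)
qed

lemma norm_edge_integral_le:
  assumes "continuous_on (closed_segment (Complex x d) (Complex y d)) h" "0 \<le> B"
     and "\<And>t. min x y \<le> t \<Longrightarrow> t \<le> max x y \<Longrightarrow> norm (h (Complex t d)) \<le> B"
  shows "norm (contour_integral (linepath (Complex x d) (Complex y d)) h) \<le> B * \<bar>y - x\<bar>"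
proof -
  have "norm (contour_integral (linepath (Complex x d) (Complex y d)) h) \<le> B * norm (Complex y d - Complex x d)"
  proof (rule contour_integral_bound_linepath[OF contour_integrable_continuous_linepath[OF assms(1)] assms(2)])
    fix z assume "z \<in> closed_segment (Complex x d) (Complex y d)"
    hence "Im z = d" "Re z \<in> closed_segment x y" by (auto simp: closed_segment_same_Im)
    hence "z = Complex (Re z) d" "min x y \<le> Re z" "Re z \<le> max x y"
      by (auto simp: closed_segment_eq_real_ivl complex_eq_iff split: if_splits)
    thus "norm (h z) \<le> B" using assms(3) by metis
  qed
  also have "norm (Complex y d - Complex x d) = \<bar>y - x\<bar>" by (simp add: norm_complex_def)
  finally show ?thesis .
qed

lemma exp_2pi_i_eq_1_iff:
  "exp (2 * of_real pi * \<i> * z) = 1 \<longleftrightarrow> z \<in> \<int>"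
proof
  assume "exp (2 * of_real pi * \<i> * z) = 1"
  then obtain n :: int where n: "Re (2 * of_real pi * \<i> * z) = 0" "Im (2 * of_real pi * \<i> * z) = of_int (2 * n) * pi"
    unfolding exp_eq_1 by auto
  hence "z = of_int n" by (auto simp: complex_eq_iff)
  thus "z \<in> \<int>" by simp
next
  assume "z \<in> \<int>"
  then obtain n where n: "z = of_int n" by (auto elim: Ints_cases)
  show "exp (2 * of_real pi * \<i> * z) = 1"
    unfolding exp_eq_1 by (rule conjI, simp add: n, rule exI[of _ n], simp add: n)
qed

text \<open>
A finite Abel--Plana formula with half-integer end points. The sum is the sum of the residues of
\<open>g z / (exp (2 * pi * \<i> * z) - 1)\<close> in a rectangle. In the upper half the kernel tends to \<open>-1\<close>, and Cauchy's
theorem for \<open>g\<close> on the upper half of the rectangle turns this constant part into the integral of \<open>g\<close>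
along the real axis. What is left decays like \<open>exp (- 2 * pi * \<bar>Im z\<bar>)\<close>, so the horizontal edges are
negligible as soon as \<open>g\<close> grows more slowly than that.
\<close>
theorem abel_plana_midpoint:
  fixes g :: "complex \<Rightarrow> complex"
  assumes hol: "g holomorphic_on {z. 0 < Re z \<and> Re z < real n}" and n: "n \<ge> 2" and T: "T > 0"
  assumes M: "\<And>x. 1 / 2 \<le> x \<Longrightarrow> x \<le> real n - 1 / 2 \<Longrightarrow> norm (g (Complex x T)) \<le> M"
             "\<And>x. 1 / 2 \<le> x \<Longrightarrow> x \<le> real n - 1 / 2 \<Longrightarrow> norm (g (Complex x (-T))) \<le> M"
  shows "norm ((\<Sum>j = 1..<n. g (of_nat j)) -
           (contour_integral (linepath (of_real (1 / 2)) (of_real (real n - 1 / 2))) g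
            + ap_edge g (1 / 2) T - ap_edge g (real n - 1 / 2) T))
         \<le> 2 * M * (real n - 1) / (exp (2 * pi * T) - 1)"
proof -
  define a b where "a = (1 / 2 :: real)" and "b = real n - 1 / 2"
  define S where "S = {z. 0 < Re z \<and> Re z < real n}"
  have S: "open S" "convex S"
  proof -
    have eq: "S = {z. Re z > 0} \<inter> {z. Re z < real n}" by (auto simp: S_def)
    show "open S" unfolding eq by (intro open_Int open_halfspace_Re_gt open_halfspace_Re_lt)
    show "convex S" unfolding eq by (intro convex_Int convex_halfspace_Re_gt convex_halfspace_Re_lt)
  qed
  have ab: "0 < a" "a < b" "b < real n" using n by (auto simp: a_def b_def)
  define e where "e = (\<lambda>z::complex. exp (2 * of_real pi * \<i> * z))"
  define Q where "Q = (\<lambda>z. g z / (e z - 1))"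
  define pts where "pts = (of_nat :: nat \<Rightarrow> complex) ` {1..<n}"
  have holg: "g holomorphic_on S" using hol by (simp add: S_def)
  have e1: "e z \<noteq> 1" if "z \<in> S - pts" for z
  proof
    assume "e z = 1"
    then obtain m where m: "z = of_int m" unfolding e_def exp_2pi_i_eq_1_iff by (auto elim: Ints_cases)
    with that have "0 < m" "m < int n" by (auto simp: S_def)
    hence "z = of_nat (nat m)" "nat m \<in> {1..<n}" using m by auto
    with that show False unfolding pts_def by blast
  qed
  have holQ: "Q holomorphic_on S - pts"
    unfolding Q_def e_def using e1
    by (intro holomorphic_intros holomorphic_on_subset[OF holg]) (auto simp: e_def)
  have res: "residue Q p = g p / (2 * of_real pi * \<i>)" if "p \<in> pts" for p
  proof -
    from that obtain j where j: "p = of_nat j" "1 \<le> j" "j < n" by (auto simp: pts_def)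
    hence pS: "p \<in> S" by (auto simp: S_def)
    have ep: "e p = 1" using j by (auto simp: e_def exp_2pi_i_eq_1_iff)
    have d: "((\<lambda>z. e z - 1) has_field_derivative (2 * of_real pi * \<i>)) (at p)"
      using ep unfolding e_def by (auto intro!: derivative_eq_intros)
    have hole: "(\<lambda>z. e z - 1) holomorphic_on S" unfolding e_def by (intro holomorphic_intros)
    \<comment> \<open>Dividing out the simple zero of \<open>e z - 1\<close> gives the residue also where \<open>g\<close> vanishes.\<close>
    define E where "E = (\<lambda>z. if z = p then deriv (\<lambda>z. e z - 1) p else ((e z - 1) - (e p - 1)) / (z - p))"
    have holE: "E holomorphic_on S"
      using pole_lemma_open[OF hole S(1), of p] by (simp add: E_def)
    have Ep: "E p = 2 * of_real pi * \<i>" using d by (simp add: E_def DERIV_imp_deriv)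
    have E0: "E z \<noteq> 0" if "z \<in> S - (pts - {p})" for z
    proof (cases "z = p")
      case False
      with that have "e z \<noteq> 1" by (intro e1) auto
      with False ep show ?thesis by (simp add: E_def)
    qed (simp add: Ep)
    have op: "open (S - (pts - {p}))" "p \<in> S - (pts - {p})" using S pS
      by (auto intro!: open_Diff finite_imp_closed simp: pts_def)
    have hol: "(\<lambda>z. g z / E z) holomorphic_on (S - (pts - {p}))"
      by (intro holomorphic_intros holomorphic_on_subset[OF holE] holomorphic_on_subset[OF holg])
         (use E0 in auto)
    have "residue Q p = residue (\<lambda>z. (g z / E z) / (z - p)) p"
      by (rule residue_cong) (use ep in \<open>auto simp: eventually_at_filter Q_def E_def\<close>)
    also have "\<dots> = g p / (2 * of_real pi * \<i>)" using residue_simple[OF op hol] Ep by simp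
    finally show ?thesis .
  qed
  have cS: "cbox (Complex a (-T)) (Complex b T) \<subseteq> S" using ab by (auto simp: S_def in_cbox_complex_iff)
  have bdry: "z \<notin> pts" if "z \<in> path_image (rectpath (Complex a (-T)) (Complex b T))" for z
  proof
    assume "z \<in> pts"
    then obtain j where j: "z = of_nat j" by (auto simp: pts_def)
    from that have "real j = a \<or> real j = b" using ab T j
      by (subst (asm) path_image_rectpath) auto
    thus False
    proof
      assume "real j = a" hence "real (2 * j) = real 1" by (simp add: a_def)
      hence "2 * j = 1" unfolding of_nat_eq_iff .
      thus False by presburger
    next
      assume "real j = b" hence "real (2 * j + 1) = real (2 * n)" by (simp add: b_def)
      hence "2 * j + 1 = 2 * n" unfolding of_nat_eq_iff .
      thus False by presburger
    qed
  qed
  have pimg: "path_image (rectpath (Complex a (-T)) (Complex b T)) \<subseteq> S - pts"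
    using path_image_rectpath_subset_cbox[of "Complex a (-T)" "Complex b T"] cS bdry ab T by auto
  have "contour_integral (rectpath (Complex a (-T)) (Complex b T)) Q
      = 2 * pi * \<i> * (\<Sum>p\<in>pts. winding_number (rectpath (Complex a (-T)) (Complex b T)) p * residue Q p)"
  proof (rule Residue_theorem[OF S(1) convex_connected[OF S(2)] _ holQ])
    show "\<forall>z. z \<notin> S \<longrightarrow> winding_number (rectpath (Complex a (- T)) (Complex b T)) z = 0"
      using cS ab T by (intro allI impI winding_number_rectpath_outside) auto
  qed (use pimg in \<open>auto simp: pts_def\<close>)
  also have "(\<Sum>p\<in>pts. winding_number (rectpath (Complex a (-T)) (Complex b T)) p * residue Q p)
      = (\<Sum>p\<in>pts. g p / (2 * of_real pi * \<i>))"
  proof (rule sum.cong)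
    fix p assume p: "p \<in> pts"
    then obtain j where j: "p = of_nat j" "1 \<le> j" "j < n" by (auto simp: pts_def)
    have "real 1 \<le> real j" "real j + 1 \<le> real n" using j by linarith+
    hence "p \<in> box (Complex a (-T)) (Complex b T)" using j T by (auto simp: in_box_complex_iff a_def b_def)
    thus "winding_number (rectpath (Complex a (-T)) (Complex b T)) p * residue Q p = g p / (2 * of_real pi * \<i>)"
      using res[OF p] by (simp add: winding_number_rectpath)
  qed simp
  also have "2 * pi * \<i> * \<dots> = (\<Sum>p\<in>pts. g p)" by (simp add: sum_divide_distrib[symmetric])
  also have "\<dots> = (\<Sum>j=1..<n. g (of_nat j))" unfolding pts_def
    by (subst sum.reindex) (auto simp: inj_on_def)
  finally have sum: "(\<Sum>j=1..<n. g (of_nat j)) = contour_integral (rectpath (Complex a (-T)) (Complex b T)) Q" ..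

  have contg: "continuous_on A g" if "A \<subseteq> S" for A
    using holomorphic_on_imp_continuous_on[OF holg] that by (rule continuous_on_subset)
  have contQ: "continuous_on A Q" if "A \<subseteq> S - pts" for A
    using holomorphic_on_imp_continuous_on[OF holQ] that by (rule continuous_on_subset)
  have line: "continuous_on {z. Re z = a} g" "continuous_on {z. Re z = b} g"
    using ab by (auto intro!: contg simp: S_def)
  have V: "contour_integral (linepath (Complex c (-T)) (Complex c T)) Q
      = - ap_edge g c T - contour_integral (linepath (Complex c 0) (Complex c T)) g" if "c \<in> {a, b}" for c
  proof -
    have "a = real 1 - 1 / 2" by (simp add: a_def)
    from ap_vertical_edge[OF line(1) this T] ap_vertical_edge[OF line(2) b_def T] that
    show ?thesis unfolding Q_def e_def by blast
  qed
  have split: "contour_integral (rectpath (Complex a (-T)) (Complex b T)) Q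
     = contour_integral (linepath (Complex a (-T)) (Complex b (-T))) Q
     + contour_integral (linepath (Complex b (-T)) (Complex b T)) Q
     + contour_integral (linepath (Complex b T) (Complex a T)) Q
     - contour_integral (linepath (Complex a (-T)) (Complex a T)) Q"
    using ab T pimg by (intro contour_integral_rectpath_split contQ) auto

  have pimg0: "path_image (rectpath (Complex a 0) (Complex b T)) \<subseteq> S"
    using path_image_rectpath_subset_cbox[of "Complex a 0" "Complex b T"] ab T
    by (auto simp: S_def in_cbox_complex_iff subset_iff)
  have "contour_integral (rectpath (Complex a 0) (Complex b T)) g = 0"
    using pimg0 S by (intro contour_integral_unique Cauchy_theorem_convex_simple[OF holg]) auto
  hence cauchy: "contour_integral (linepath (Complex a 0) (Complex b 0)) g
     + contour_integral (linepath (Complex b 0) (Complex b T)) g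
     + contour_integral (linepath (Complex b T) (Complex a T)) g
     - contour_integral (linepath (Complex a 0) (Complex a T)) g = 0"
    using contour_integral_rectpath_split[of a 0 b T g] ab T contg[OF pimg0] by simp

  \<comment> \<open>The two error terms: the bottom edge carries the kernel itself, the top edge the kernel plus \<open>1\<close>.\<close>
  define R1 where "R1 = contour_integral (linepath (Complex a (-T)) (Complex b (-T))) Q"
  define R2 where "R2 = contour_integral (linepath (Complex b T) (Complex a T)) (\<lambda>z. Q z + g z)"
  have seg: "closed_segment (Complex a (-T)) (Complex b (-T)) \<subseteq> S - pts"
     "closed_segment (Complex b T) (Complex a T) \<subseteq> S - pts"
    using pimg by (auto simp: rectpath_def Let_def path_image_join)
  have seg': "closed_segment (Complex b T) (Complex a T) \<subseteq> S" using seg by auto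
  have R2: "R2 = contour_integral (linepath (Complex b T) (Complex a T)) Q
       + contour_integral (linepath (Complex b T) (Complex a T)) g"
    unfolding R2_def
    by (rule contour_integral_add) (intro contour_integrable_continuous_linepath contQ contg seg seg')+
  have "(\<Sum>j=1..<n. g (of_nat j)) - (contour_integral (linepath (Complex a 0) (Complex b 0)) g
            + ap_edge g a T - ap_edge g b T) = R1 + R2"
  proof -
    have "contour_integral (linepath (Complex a 0) (Complex b 0)) g
       = contour_integral (linepath (Complex a 0) (Complex a T)) g
       - contour_integral (linepath (Complex b 0) (Complex b T)) g
       - contour_integral (linepath (Complex b T) (Complex a T)) g"
      using cauchy by (simp only: eq_iff_diff_eq_0[of "contour_integral (linepath (Complex a 0) (Complex b 0)) g"])
        (simp add: algebra_simps)
    moreover note V[OF insertI1] V[OF insertI2[OF singletonI]]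
    ultimately show ?thesis unfolding sum split R1_def R2 by (simp only:) (simp add: algebra_simps)
  qed
  moreover have M0: "M \<ge> 0" using M(1)[of a] ab order_trans[OF norm_ge_zero] by (auto simp: a_def b_def)
  define D where "D = exp (2 * pi * T) - 1"
  have D: "D > 0" using T by (simp add: D_def)
  have ab': "\<bar>b - a\<bar> = real n - 1" "\<bar>a - b\<bar> = real n - 1" using n by (simp_all add: a_def b_def)
  have ne: "norm (exp (2 * of_real pi * \<i> * complex_of_real x)) = 1" for x
    by (metis mult.commute mult.left_commute norm_exp_i_times of_real_mult of_real_numeral)
  have "norm R1 \<le> M / D * \<bar>b - a\<bar>"
    unfolding R1_def
  proof (rule norm_edge_integral_le[OF contQ[OF seg(1)]])
    fix x assume "min a b \<le> x" "x \<le> max a b"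
    hence x: "1 / 2 \<le> x" "x \<le> real n - 1 / 2" using ab by (auto simp: a_def b_def)
    have "norm (e (Complex x (-T))) = exp (2 * pi * T)"
      unfolding e_def exp_2pi_i_Complex norm_mult ne by simp
    hence "D \<le> norm (e (Complex x (-T)) - 1)"
      unfolding D_def using norm_triangle_ineq2[of "e (Complex x (-T))" 1] by simp
    thus "norm (Q (Complex x (-T))) \<le> M / D"
      unfolding Q_def norm_divide using M(2)[OF x] D M0 by (intro frac_le) auto
  qed (use M0 D in auto)
  moreover have "norm R2 \<le> M / D * \<bar>a - b\<bar>"
    unfolding R2_def
  proof (rule norm_edge_integral_le)
    fix x assume "min b a \<le> x" "x \<le> max b a"
    hence x: "1 / 2 \<le> x" "x \<le> real n - 1 / 2" using ab by (auto simp: a_def b_def)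
    let ?z = "Complex x T"
    have ne: "norm (e ?z) = exp (- 2 * pi * T)"
      unfolding e_def exp_2pi_i_Complex norm_mult ne by simp
    have lt: "exp (- 2 * pi * T) < 1" using T by simp
    have "1 - exp (- 2 * pi * T) \<le> norm (e ?z - 1)"
      using norm_triangle_ineq2[of 1 "e ?z"] ne by (simp add: norm_minus_commute)
    hence "norm (e ?z) / norm (e ?z - 1) \<le> exp (- 2 * pi * T) / (1 - exp (- 2 * pi * T))"
      unfolding ne using lt by (intro frac_le) auto
    also have "\<dots> = 1 / D" unfolding D_def using lt by (simp add: exp_minus field_simps)
    finally have le: "norm (e ?z) / norm (e ?z - 1) \<le> 1 / D" .
    have "e ?z \<noteq> 1" using ne lt by auto
    hence "Q ?z + g ?z = g ?z * (e ?z / (e ?z - 1))" unfolding Q_def by (simp add: field_simps)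
    also have "norm \<dots> \<le> M * (1 / D)"
      unfolding norm_mult norm_divide by (intro mult_mono le M(1) x) (use M0 in auto)
    finally show "norm (Q ?z + g ?z) \<le> M / D" by simp
  qed (use M0 D in \<open>auto intro!: continuous_intros contQ contg seg seg'\<close>)
  moreover have "complex_of_real (1/2) = Complex a 0" "complex_of_real (real n - 1/2) = Complex b 0"
    by (simp_all add: complex_eq_iff a_def b_def)
  ultimately have "norm ((\<Sum>j=1..<n. g (of_nat j)) - (contour_integral (linepath (Complex a 0) (Complex b 0)) g
            + ap_edge g a T - ap_edge g b T)) \<le> 2 * M * (real n - 1) / D"
    using norm_triangle_ineq[of R1 R2] unfolding ab' by simp
  moreover have "complex_of_real (1/2) = Complex a 0" "complex_of_real (real n - 1/2) = Complex b 0"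
    by (simp_all add: complex_eq_iff a_def b_def)
  ultimately show ?thesis unfolding D_def a_def b_def by (simp only:)
qed

section \<open>Analytic continuation of the zeta function\<close>

lemma ap_kernel_bounds: "0 \<le> ap_kernel t" "ap_kernel t \<le> exp (- 2 * pi * t)"
proof -
  have "1 / (exp (2 * pi * t) + 1) \<le> 1 / exp (2 * pi * t)"
    by (intro divide_left_mono) (auto intro!: mult_pos_pos add_pos_pos)
  thus "ap_kernel t \<le> exp (- 2 * pi * t)" by (simp add: ap_kernel_def exp_minus field_simps)
  show "0 \<le> ap_kernel t" by (simp add: ap_kernel_def add_nonneg_nonneg)
qed

lemma norm_powr_le:
  fixes y a :: complex
  assumes "y \<noteq> 0"
  shows "norm (y powr a) \<le> norm y powr Re a * exp (pi * \<bar>Im a\<bar>)"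
proof -
  have "norm (y powr a) = exp (Re (a * Ln y))"
    using assms by (simp add: powr_def norm_exp_eq_Re)
  also have "Re (a * Ln y) = Re a * ln (norm y) - Im a * Im (Ln y)"
    using assms by (simp add: Re_Ln)
  also have "- (Im a * Im (Ln y)) \<le> \<bar>Im a\<bar> * pi"
  proof -
    have "\<bar>Im (Ln y)\<bar> \<le> pi" using Im_Ln_le_pi[OF assms] mpi_less_Im_Ln[OF assms] by linarith
    hence "\<bar>Im a * Im (Ln y)\<bar> \<le> \<bar>Im a\<bar> * pi" by (simp add: abs_mult mult_left_mono)
    thus ?thesis by linarith
  qed
  hence "exp (Re a * ln (norm y) - Im a * Im (Ln y)) \<le> exp (Re a * ln (norm y) + \<bar>Im a\<bar> * pi)" by simp
  also have "\<dots> = norm y powr Re a * exp (pi * \<bar>Im a\<bar>)"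
    using assms by (simp add: exp_add powr_def mult.commute)
  finally show ?thesis .
qed

text \<open>
On the line \<open>Re y = 1/2\<close> a power \<open>y powr a\<close> grows at most polynomially in \<open>t = \<bar>Im y\<bar>\<close>, with a degree
bounded by \<open>norm a\<close>; the kernel wins, uniformly for bounded \<open>a\<close>. The bound \<open>exp (- t)\<close> is far from sharp but
easy to integrate.
\<close>
lemma ap_half_line_decay:
  assumes "m \<ge> 0"
  obtains M where "M \<ge> 0"
    "\<And>t a b. 0 \<le> t \<Longrightarrow> norm a \<le> m \<Longrightarrow> \<bar>b\<bar> = t \<Longrightarrow>
       ap_kernel t * norm (Complex (1 / 2) b powr a) \<le> M * exp (- t)"
proof
  define M where "M = exp (m * ln (2 * (m + 1)) + 1 + m * pi)"
  show "M \<ge> 0" by (simp add: M_def)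
  fix t b :: real and a :: complex
  assume t: "0 \<le> t" and a: "norm a \<le> m" and b: "\<bar>b\<bar> = t"
  define y where "y = Complex (1 / 2) b"
  have y: "1 / 2 \<le> norm y" "norm y \<le> 1 / 2 + t"
    using complex_Re_le_cmod[of y] cmod_le[of y] b by (simp_all add: y_def)
  hence y0: "y \<noteq> 0" by auto
  have ly: "\<bar>ln (norm y)\<bar> \<le> ln (2 + 2 * t)"
  proof -
    have "norm y \<le> 2 + 2 * t" using y t by linarith
    hence "ln (norm y) \<le> ln (2 + 2 * t)" using y0 t by (subst ln_le_cancel_iff) auto
    moreover have "1 \<le> norm y * (2 + 2 * t)"
      using mult_mono[of "1/2" "norm y" 2 "2 + 2 * t"] y t by simp
    hence "0 \<le> ln (norm y * (2 + 2 * t))" by (rule ln_ge_zero)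
    hence "- ln (norm y) \<le> ln (2 + 2 * t)" using y0 t by (simp add: ln_mult)
    ultimately show ?thesis by linarith
  qed
  \<comment> \<open>Scaling by \<open>m + 1\<close> before using \<open>ln x \<le> x\<close> gives \<open>m * ln (2 + 2 * t) \<le> t\<close> up to a constant.\<close>
  have "ln ((1 + t) / (m + 1)) \<le> (1 + t) / (m + 1)"
    using t assms by (intro order_trans[OF ln_le_minus_one]) auto
  moreover have "ln (2 + 2 * t) = ln (2 * (m + 1)) + ln ((1 + t) / (m + 1))"
  proof -
    have "2 + 2 * t = (2 * (m + 1)) * ((1 + t) / (m + 1))" using assms by (simp add: field_simps)
    thus ?thesis using t assms by (simp only:) (rule ln_mult_pos, auto)
  qed
  ultimately have "m * ln (2 + 2 * t) \<le> m * (ln (2 * (m + 1)) + (1 + t) / (m + 1))"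
    using assms by (intro mult_left_mono) auto
  also have "\<dots> = m * ln (2 * (m + 1)) + m / (m + 1) * (1 + t)" by (simp add: algebra_simps)
  also have "m / (m + 1) * (1 + t) \<le> 1 * (1 + t)" using assms t by (intro mult_right_mono) auto
  finally have 1: "m * ln (2 + 2 * t) \<le> m * ln (2 * (m + 1)) + 1 + t" by simp
  have "norm (y powr a) \<le> exp (Re a * ln (norm y) + pi * \<bar>Im a\<bar>)"
    using norm_powr_le[OF y0, of a] y0 by (simp add: exp_add powr_def)
  also have "Re a * ln (norm y) + pi * \<bar>Im a\<bar> \<le> m * ln (2 + 2 * t) + m * pi"
  proof -
    have "Re a * ln (norm y) \<le> \<bar>Re a\<bar> * \<bar>ln (norm y)\<bar>" by (metis abs_ge_self abs_mult)
    also have "\<dots> \<le> m * ln (2 + 2 * t)"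
      using ly a abs_Re_le_cmod[of a] assms by (intro mult_mono) auto
    finally show ?thesis using a abs_Im_le_cmod[of a] by (simp add: mult.commute add_mono)
  qed
  also have "\<dots> \<le> m * ln (2 * (m + 1)) + 1 + t + m * pi" using 1 by simp
  finally have "norm (y powr a) \<le> M * exp t" by (simp add: M_def exp_add mult_ac)
  hence "ap_kernel t * norm (y powr a) \<le> exp (- 2 * pi * t) * (M * exp t)"
    by (intro mult_mono ap_kernel_bounds) (auto simp: M_def)
  also have "\<dots> = M * exp (t - 2 * pi * t)" by (simp add: exp_diff exp_minus field_simps)
  also have "\<dots> \<le> M * exp (- t)"
    using mult_right_mono[of 1 pi t] t pi_ge_two by (auto simp: M_def)
  finally show "ap_kernel t * norm (Complex (1 / 2) b powr a) \<le> M * exp (- t)" by (simp add: y_def)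
qed

lemma integral_le_exp_bound:
  fixes h :: "real \<Rightarrow> complex"
  assumes cont: "continuous_on {0..T} h" and M: "0 \<le> M" and T: "0 \<le> T"
    and le: "\<And>t. 0 \<le> t \<Longrightarrow> t \<le> T \<Longrightarrow> norm (h t) \<le> M * exp (- t)"
  shows "norm (integral {0..T} h) \<le> M"
proof -
  have gT: "((\<lambda>t. M * exp (- t)) has_integral (- M * exp (- T) - (- M * exp (- 0)))) {0..T}"
    using T by (intro fundamental_theorem_of_calculus)
      (auto intro!: derivative_eq_intros simp flip: has_real_derivative_iff_has_vector_derivative)
  have "norm (integral {0..T} h) \<le> - M * exp (- T) - (- M * exp (- 0))"
    using integral_norm_bound_integral[OF integrable_continuous_interval[OF cont] has_integral_integrable[OF gT]]
      le integral_unique[OF gT] by auto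
  also have "\<dots> \<le> M" using M by simp
  finally show ?thesis .
qed

lemma half_line_integral_tail:
  fixes h :: "real \<Rightarrow> complex"
  assumes cont: "continuous_on {0..} h" and le: "\<And>t. 0 \<le> t \<Longrightarrow> norm (h t) \<le> M * exp (- t)"
  shows "0 \<le> T \<Longrightarrow> norm (integral {0..} h - integral {0..T} h) \<le> M * exp (- T)"
proof -
  have gi: "((\<lambda>t. M * exp (- t)) has_integral M * exp (- c)) {c..}" for c
    using has_integral_mult_right[OF has_integral_exp_minus_to_infinity[of 1 c], of M] by simp
  have int: "h integrable_on {c..}" if "c \<ge> 0" for c
  proof (rule measurable_bounded_by_integrable_imp_integrable)
    show "h \<in> borel_measurable (lebesgue_on {c..})"
      using that by (intro continuous_imp_measurable_on_sets_lebesgue continuous_on_subset[OF cont]) auto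
    show "(\<lambda>t. M * exp (- t)) integrable_on {c..}" using gi by blast
  qed (use le that in auto)
  have bnd: "norm (integral {c..} h) \<le> M * exp (- c)" if "c \<ge> 0" for c
    using integral_norm_bound_integral[OF int[OF that] has_integral_integrable[OF gi[of c]]] le that
      integral_unique[OF gi[of c]] by auto
  assume T: "0 \<le> T"
  have intT: "h integrable_on {0..T}"
    by (intro integrable_continuous_interval continuous_on_subset[OF cont]) auto
  have "{0..} = {0..T} \<union> {T..}" using T by auto
  hence "integral {0..} h = integral {0..T} h + integral {T..} h"
    using integral_Un[OF intT int[OF T]] T by (simp add: Int_atLeastAtMostL2)
  thus "norm (integral {0..} h - integral {0..T} h) \<le> M * exp (- T)" using bnd[OF T] by simp
qed

text \<open>
The Abel--Plana correction for \<open>y powr (-a)\<close> on the whole line \<open>Re y = 1/2\<close>. It is entire in \<open>a\<close> and carries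
the analytic continuation of \<open>zeta\<close>.
\<close>
definition zeta_edge :: "complex \<Rightarrow> complex" where
  "zeta_edge a = \<i> * integral {0..}
     (\<lambda>t. of_real (ap_kernel t) * (Complex (1 / 2) (-t) powr (-a) - Complex (1 / 2) t powr (-a)))"

lemma continuous_on_half_line_powr [continuous_intros]:
  assumes "continuous_on A h" "0 < c"
  shows "continuous_on A (\<lambda>t. Complex c (h t) powr a)"
proof -
  have "continuous_on A (\<lambda>t. Complex c (h t))"
    unfolding Complex_eq using assms by (intro continuous_intros)
  thus ?thesis by (intro continuous_intros) (use assms in \<open>auto simp: complex_nonpos_Reals_iff complex_eq_iff\<close>)
qed

lemma ap_edge_powr_tendsto:
  assumes "m \<ge> 0"
  obtains M where "M \<ge> 0"
    "\<And>a T. norm a \<le> m \<Longrightarrow> 0 \<le> T \<Longrightarrow>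
       norm (zeta_edge a - ap_edge (\<lambda>y. y powr (-a)) (1 / 2) T) \<le> M * exp (- T)"
proof -
  obtain M where M: "M \<ge> 0" "\<And>t a b. 0 \<le> t \<Longrightarrow> norm a \<le> m \<Longrightarrow> \<bar>b\<bar> = t \<Longrightarrow>
       ap_kernel t * norm (Complex (1 / 2) b powr a) \<le> M * exp (- t)"
    using ap_half_line_decay[OF assms] by blast
  show thesis
  proof
    show "2 * M \<ge> 0" using M by simp
    fix a :: complex and T :: real
    assume a: "norm a \<le> m" and T: "0 \<le> T"
    define h where "h = (\<lambda>t. of_real (ap_kernel t) * (Complex (1 / 2) (-t) powr (-a) - Complex (1 / 2) t powr (-a)))"
    have ch: "continuous_on {0..} h" unfolding h_def by (intro continuous_intros) auto
    have nh: "norm (h t) \<le> 2 * M * exp (- t)" if "0 \<le> t" for t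
    proof -
      have "norm (h t) = ap_kernel t * norm (Complex (1 / 2) (-t) powr (-a) - Complex (1 / 2) t powr (-a))"
        by (simp add: h_def norm_mult ap_kernel_bounds)
      also have "\<dots> \<le> ap_kernel t * (norm (Complex (1 / 2) (-t) powr (-a)) + norm (Complex (1 / 2) t powr (-a)))"
        by (intro mult_left_mono norm_triangle_ineq4 ap_kernel_bounds)
      also have "\<dots> \<le> 2 * M * exp (- t)"
        using M(2)[of t "-a" t] M(2)[of t "-a" "-t"] that a by (simp add: algebra_simps)
      finally show ?thesis .
    qed
    have "zeta_edge a - ap_edge (\<lambda>y. y powr (-a)) (1 / 2) T = \<i> * (integral {0..} h - integral {0..T} h)"
      by (simp add: zeta_edge_def ap_edge_def h_def algebra_simps)
    thus "norm (zeta_edge a - ap_edge (\<lambda>y. y powr (-a)) (1 / 2) T) \<le> 2 * M * exp (- T)"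
      using half_line_integral_tail[OF ch nh T] by (simp add: norm_mult)
  qed
qed

lemma holomorphic_ap_edge_powr:
  "(\<lambda>a. ap_edge (\<lambda>y. y powr (-a)) (1 / 2) T) holomorphic_on UNIV"
proof -
  have nz: "Complex (1/2) t \<noteq> 0" for t by (simp add: complex_eq_iff)
  have "(\<lambda>a. integral (cbox 0 T) (\<lambda>t. of_real (ap_kernel t) * (Complex (1 / 2) (-t) powr (-a) - Complex (1 / 2) t powr (-a))))
     holomorphic_on UNIV"
  proof (rule leibniz_rule_holomorphic)
    fix a :: complex and t :: real
    show "((\<lambda>a. of_real (ap_kernel t) * (Complex (1 / 2) (-t) powr (-a) - Complex (1 / 2) t powr (-a)))
      has_field_derivative (of_real (ap_kernel t) * (- Ln (Complex (1 / 2) (-t)) * Complex (1 / 2) (-t) powr (-a)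
         + Ln (Complex (1 / 2) t) * Complex (1 / 2) t powr (-a)))) (at a)"
      using nz by (auto intro!: derivative_eq_intros simp: powr_def)
  next
    fix a :: complex
    show "(\<lambda>t. of_real (ap_kernel t) * (Complex (1 / 2) (-t) powr (-a) - Complex (1 / 2) t powr (-a))) integrable_on cbox 0 T"
      by (intro integrable_continuous continuous_intros) auto
  next
    have c: "continuous_on (UNIV \<times> cbox 0 T) (\<lambda>x. Complex (1/2) (h (snd x)))" if "continuous_on UNIV h" for h
      unfolding Complex_eq by (intro continuous_intros continuous_on_compose2[OF that]) auto
    have c1: "continuous_on (UNIV \<times> cbox 0 T) (\<lambda>x. Ln (Complex (1/2) (h (snd x))))"
      if "continuous_on UNIV h" for h :: "real \<Rightarrow> real"
      by (rule continuous_on_Ln'[OF c[OF that]]) (auto simp: complex_nonpos_Reals_iff)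
    have c2: "continuous_on (UNIV \<times> cbox 0 T) (\<lambda>x. Complex (1/2) (h (snd x)) powr (- fst x))"
      if "continuous_on UNIV h" for h :: "real \<Rightarrow> real"
      using c1[OF that]
      by (auto simp: powr_def nz intro!: continuous_on_exp continuous_on_mult continuous_on_minus continuous_on_fst)
    show "continuous_on (UNIV \<times> cbox 0 T) (\<lambda>(a, t). of_real (ap_kernel t) *
        (- Ln (Complex (1 / 2) (-t)) * Complex (1 / 2) (-t) powr (-a)
         + Ln (Complex (1 / 2) t) * Complex (1 / 2) t powr (-a)))"
      unfolding case_prod_unfold
      by (intro continuous_on_add continuous_on_mult continuous_on_minus continuous_on_of_real continuous_on_ap_kernel
            continuous_on_snd continuous_on_id c1[of uminus] c1[of "\<lambda>x. x"] c2[of uminus] c2[of "\<lambda>x. x"])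
  qed auto
  thus ?thesis unfolding ap_edge_def by (intro holomorphic_intros) simp
qed

lemma holomorphic_zeta_edge: "zeta_edge holomorphic_on UNIV"
proof (rule holomorphic_uniform_sequence)
  show "(\<lambda>a. ap_edge (\<lambda>y. y powr (-a)) (1 / 2) (real n)) holomorphic_on UNIV" for n
    by (rule holomorphic_ap_edge_powr)
  fix z :: complex
  obtain M where M: "M \<ge> 0" "\<And>a T. norm a \<le> norm z + 1 \<Longrightarrow> 0 \<le> T \<Longrightarrow>
       norm (zeta_edge a - ap_edge (\<lambda>y. y powr (-a)) (1 / 2) T) \<le> M * exp (- T)"
    using ap_edge_powr_tendsto[of "norm z + 1"] by auto
  have "uniform_limit (cball z 1) (\<lambda>n a. ap_edge (\<lambda>y. y powr (-a)) (1 / 2) (real n)) zeta_edge sequentially"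
  proof (rule uniform_limitI)
    fix e :: real assume "e > 0"
    have "(\<lambda>n. M * exp (- real n)) \<longlonglongrightarrow> 0" by real_asymp
    hence "eventually (\<lambda>n. M * exp (- real n) < e) sequentially" using \<open>e > 0\<close> by (rule order_tendstoD)
    thus "\<forall>\<^sub>F n in sequentially. \<forall>a\<in>cball z 1. dist (ap_edge (\<lambda>y. y powr (-a)) (1 / 2) (real n)) (zeta_edge a) < e"
    proof eventually_elim
      case (elim n)
      show ?case
      proof
        fix a assume "a \<in> cball z 1"
        hence "norm (a - z) \<le> 1" by (simp add: dist_norm norm_minus_commute)
        hence "norm a \<le> norm z + 1" using norm_triangle_ineq2[of a z] by linarith
        from M(2)[OF this, of "real n"] elim show "dist (ap_edge (\<lambda>y. y powr (-a)) (1 / 2) (real n)) (zeta_edge a) < e"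
          by (simp add: dist_norm norm_minus_commute)
      qed
    qed
  qed
  thus "\<exists>d>0. cball z d \<subseteq> UNIV \<and>
     uniform_limit (cball z d) (\<lambda>n a. ap_edge (\<lambda>y. y powr (-a)) (1 / 2) (real n)) zeta_edge sequentially"
    by (intro exI[of _ 1]) auto
qed auto

lemma contour_integral_powr_linepath:
  fixes a z w :: complex
  assumes "closed_segment z w \<inter> \<real>\<^sub>\<le>\<^sub>0 = {}" "a \<noteq> -1"
  shows "contour_integral (linepath z w) (\<lambda>y. y powr a) = (w powr (a + 1) - z powr (a + 1)) / (a + 1)"
proof -
  have "((\<lambda>y. y powr a) has_contour_integral
     ((\<lambda>y. y powr (a + 1) / (a + 1)) (pathfinish (linepath z w)) - (\<lambda>y. y powr (a + 1) / (a + 1)) (pathstart (linepath z w)))) (linepath z w)"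
  proof (rule contour_integral_primitive[where S = "closed_segment z w"])
    fix x assume x: "x \<in> closed_segment z w"
    have "a + 1 \<noteq> 0" using assms(2) by (metis add_eq_0_iff2)
    thus "((\<lambda>y. y powr (a + 1) / (a + 1)) has_field_derivative x powr a) (at x within closed_segment z w)"
      using x assms(1) by (auto intro!: derivative_eq_intros)
  qed auto
  thus ?thesis by (simp add: contour_integral_unique diff_divide_distrib)
qed

text \<open>
The finite Abel--Plana formula for \<open>y powr (-a)\<close> in the limit of an infinite rectangle, whose height
is taken equal to its length.
\<close>
lemma zeta_abel_plana_sums:
  assumes "Re a > 1"
  shows "(\<lambda>n. of_nat (Suc n) powr (-a)) sums ((1 / 2) powr (1 - a) / (a - 1) + zeta_edge a)"
proof -
  define g where "g = (\<lambda>y::complex. y powr (-a))"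
  define C where "C = exp (pi * \<bar>Im a\<bar>)"
  have C: "C > 0" by (simp add: C_def)
  have a1: "a \<noteq> 1" using assms by auto
  have ng: "norm (g y) \<le> r powr (- Re a) * C" if "norm y \<ge> r" "r > 0" for y r
  proof -
    have "norm (g y) \<le> norm y powr (- Re a) * C"
      using norm_powr_le[of y "-a"] that unfolding g_def C_def by (cases "y = 0") auto
    also have "norm y powr (- Re a) \<le> r powr (- Re a)" using that assms by (intro powr_mono2') auto
    finally show ?thesis using C by simp
  qed
  define P where "P = (\<lambda>n. contour_integral (linepath (of_real (1/2)) (of_real (real n - 1/2))) g)"
  define L R where "L = (\<lambda>n. ap_edge g (1/2) (real n))" and "R = (\<lambda>n. ap_edge g (real n - 1/2) (real n))"
  define s where "s = (\<lambda>n. \<Sum>j = 1..<n. g (of_nat j))"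
  define E where "E = (\<lambda>n. s n - (P n + L n - R n))"
  have "(\<lambda>n. 2 * C * (real n - 1) / (exp (2 * pi * real n) - 1)) \<longlonglongrightarrow> 0"
    using C by real_asymp
  moreover have "eventually (\<lambda>n. norm (E n) \<le> 2 * C * (real n - 1) / (exp (2 * pi * real n) - 1)) sequentially"
    using eventually_ge_at_top[of 2]
  proof eventually_elim
    case (elim n)
    show ?case unfolding E_def s_def P_def L_def R_def
    proof (rule abel_plana_midpoint[OF _ elim])
      show "g holomorphic_on {z. 0 < Re z \<and> Re z < real n}"
        unfolding g_def by (intro holomorphic_intros) (auto simp: complex_nonpos_Reals_iff)
      fix x :: real
      show "norm (g (Complex x (real n))) \<le> C" "norm (g (Complex x (- real n))) \<le> C"
        using ng[of 1 "Complex x (real n)"] ng[of 1 "Complex x (- real n)"] elim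
          abs_Im_le_cmod[of "Complex x (real n)"] abs_Im_le_cmod[of "Complex x (-real n)"] by auto
    qed (use elim in auto)
  qed
  ultimately have E: "E \<longlonglongrightarrow> 0" by (rule Lim_null_comparison[rotated])
  have L: "L \<longlonglongrightarrow> zeta_edge a"
  proof -
    obtain M where M: "M \<ge> 0" "\<And>a' T. norm a' \<le> norm a \<Longrightarrow> 0 \<le> T \<Longrightarrow>
       norm (zeta_edge a' - ap_edge (\<lambda>y. y powr (-a')) (1 / 2) T) \<le> M * exp (- T)"
      using ap_edge_powr_tendsto[of "norm a"] by auto
    have "(\<lambda>n. L n - zeta_edge a) \<longlonglongrightarrow> 0"
    proof (rule Lim_null_comparison)
      show "(\<lambda>n. M * exp (- real n)) \<longlonglongrightarrow> 0" by real_asymp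
      show "\<forall>\<^sub>F n in sequentially. norm (L n - zeta_edge a) \<le> M * exp (- real n)"
        using M(2)[of a] by (auto simp: L_def g_def norm_minus_commute)
    qed
    thus ?thesis by (simp add: LIM_zero_iff)
  qed
  have R: "R \<longlonglongrightarrow> 0"
  proof (rule Lim_null_comparison)
    show "(\<lambda>n. 2 * C * (real n - 1/2) powr (- Re a)) \<longlonglongrightarrow> 0"
      using assms C by real_asymp
    show "\<forall>\<^sub>F n in sequentially. norm (R n) \<le> 2 * C * (real n - 1/2) powr (- Re a)"
      using eventually_ge_at_top[of 1]
    proof eventually_elim
      case (elim n)
      define b where "b = real n - 1/2"
      have b: "b > 0" using elim by (simp add: b_def)
      have "norm (integral {0..real n} (\<lambda>t. of_real (ap_kernel t) * (g (Complex b (-t)) - g (Complex b t)))) \<le> 2 * C * b powr (- Re a)"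
      proof (rule integral_le_exp_bound)
        show "continuous_on {0..real n} (\<lambda>t. of_real (ap_kernel t) * (g (Complex b (-t)) - g (Complex b t)))"
          unfolding g_def using b by (intro continuous_intros)
        fix t :: real assume t: "0 \<le> t"
        have "b \<le> norm (Complex b u)" for u using complex_Re_le_cmod[of "Complex b u"] by simp
        hence *: "norm (g (Complex b u)) \<le> b powr (- Re a) * C" for u by (rule ng[OF _ b])
        have "norm (of_real (ap_kernel t) * (g (Complex b (-t)) - g (Complex b t)))
           \<le> exp (- 2 * pi * t) * (b powr (- Re a) * C + b powr (- Re a) * C)"
          unfolding norm_mult
          by (intro mult_mono order_trans[OF norm_triangle_ineq4 add_mono[OF * *]])
             (use ap_kernel_bounds[of t] in auto)
        also have "exp (- 2 * pi * t) \<le> exp (- t)"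
          using mult_right_mono[of 1 pi t] t pi_ge_two by simp
        hence "exp (- 2 * pi * t) * (b powr (- Re a) * C + b powr (- Re a) * C)
          \<le> exp (- t) * (b powr (- Re a) * C + b powr (- Re a) * C)"
          using C by (intro mult_right_mono) auto
        finally show "norm (of_real (ap_kernel t) * (g (Complex b (-t)) - g (Complex b t)))
           \<le> 2 * C * b powr (- Re a) * exp (- t)" using C by (simp add: algebra_simps)
      qed (use C in auto)
      thus ?case by (simp add: R_def ap_edge_def norm_mult b_def)
    qed
  qed
  have P: "P \<longlonglongrightarrow> (1 / 2) powr (1 - a) / (a - 1)"
  proof -
    have "eventually (\<lambda>n. P n = (of_real (real n - 1/2) powr (1 - a) - (1/2) powr (1 - a)) / (1 - a)) sequentially"
      using eventually_ge_at_top[of 1]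
    proof eventually_elim
      case (elim n)
      show ?case unfolding P_def g_def
      proof (subst contour_integral_powr_linepath)
        show "closed_segment (complex_of_real (1/2)) (of_real (real n - 1/2)) \<inter> \<real>\<^sub>\<le>\<^sub>0 = {}"
          using elim unfolding closed_segment_of_real
          by (auto simp: closed_segment_eq_real_ivl complex_nonpos_Reals_iff)
      qed (use a1 in \<open>auto simp: algebra_simps\<close>)
    qed
    moreover have "(\<lambda>n. (of_real (real n - 1/2) powr (1 - a) - (1/2) powr (1 - a)) / (1 - a)) \<longlonglongrightarrow> (0 - (1/2) powr (1 - a)) / (1 - a)"
    proof (intro tendsto_intros)
      show "(\<lambda>n. complex_of_real (real n - 1/2) powr (1 - a)) \<longlonglongrightarrow> 0"
      proof (rule Lim_null_comparison)
        show "(\<lambda>n. (real n - 1/2) powr (1 - Re a)) \<longlonglongrightarrow> 0" using assms by real_asymp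
        show "\<forall>\<^sub>F n in sequentially. norm (complex_of_real (real n - 1/2) powr (1 - a)) \<le> (real n - 1/2) powr (1 - Re a)"
          using eventually_ge_at_top[of 1]
        proof eventually_elim
          case (elim n)
          thus ?case by (subst norm_powr_real_powr) auto
        qed
      qed
    qed (use a1 in auto)
    ultimately have "P \<longlonglongrightarrow> (0 - (1/2) powr (1 - a)) / (1 - a)" by (simp add: filterlim_cong)
    also have "(0 - (1/2) powr (1 - a)) / (1 - a) = (1 / 2) powr (1 - a) / (a - 1)"
      using a1 by (simp add: divide_simps) (simp add: algebra_simps)
    finally show ?thesis .
  qed
  have "(\<lambda>n. E n + (P n + L n - R n)) \<longlonglongrightarrow> 0 + ((1 / 2) powr (1 - a) / (a - 1) + zeta_edge a - 0)"
    by (intro tendsto_intros E P L R)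
  hence "s \<longlonglongrightarrow> (1 / 2) powr (1 - a) / (a - 1) + zeta_edge a" by (simp add: E_def)
  hence "(\<lambda>n. s (Suc n)) \<longlonglongrightarrow> (1 / 2) powr (1 - a) / (a - 1) + zeta_edge a" by (rule LIMSEQ_Suc)
  also have "(\<lambda>n. s (Suc n)) = (\<lambda>n. \<Sum>j<n. g (of_nat (Suc j)))"
    using sum.shift_bounds_Suc_ivl[of "\<lambda>j. g (of_nat j)" 0]
    by (simp only: s_def One_nat_def lessThan_atLeast0)
  finally show ?thesis by (simp add: sums_def g_def)
qed

text \<open>
The right-hand side is holomorphic away from \<open>1\<close>, so the function that \<open>zeta\<close> selects exists, and by the
identity theorem it is this one.
\<close>
theorem zeta_abel_plana:
  assumes "a \<noteq> 1"
  shows "zeta a = (1 / 2) powr (1 - a) / (a - 1) + zeta_edge a"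
proof -
  define Z where "Z = (\<lambda>a::complex. (1 / 2) powr (1 - a) / (a - 1) + zeta_edge a)"
  define is_zeta where "is_zeta = (\<lambda>f. f holomorphic_on (- {1}) \<and>
     (\<forall>s. Re s > 1 \<longrightarrow> (\<lambda>n. of_nat (Suc n) powr (- s)) sums f s))"
  have Zh: "Z holomorphic_on - {1}" unfolding Z_def
    by (intro holomorphic_intros holomorphic_on_subset[OF holomorphic_zeta_edge]) auto
  hence "is_zeta Z" unfolding is_zeta_def Z_def using zeta_abel_plana_sums by blast
  hence zeta: "is_zeta zeta"
    unfolding zeta_def is_zeta_def[symmetric] by (rule someI[of is_zeta])
  have "zeta a = Z a"
  proof (rule analytic_continuation_open[where s = "{s. Re s > 1}" and s' = "- {1}" and f = zeta and g = Z])
    show "connected (- {1 :: complex})" by (rule connected_punctured_universe) simp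
    have "2 \<in> {s::complex. Re s > 1}" by simp
    thus "{s::complex. Re s > 1} \<noteq> {}" by blast
    show "zeta s = Z s" if "s \<in> {s. Re s > 1}" for s
      using that zeta \<open>is_zeta Z\<close> unfolding is_zeta_def by (auto intro: sums_unique2)
  qed (use Zh zeta assms in \<open>auto simp: is_zeta_def open_halfspace_Re_gt\<close>)
  thus ?thesis by (simp add: Z_def)
qed

section \<open>The expansion at the singular end point\<close>

text \<open>
Two continuous logarithms of the same function differ by a continuous function with values in the
discrete set of multiples of \<open>2 * pi * \<i>\<close>.
\<close>
lemma continuous_log_unique:
  fixes f g :: "'a::topological_space \<Rightarrow> complex"
  assumes S: "connected S" and cont: "continuous_on S f" "continuous_on S g"
    and eq: "\<And>x. x \<in> S \<Longrightarrow> exp (f x) = exp (g x)"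
    and p: "p \<in> S" "f p = g p" and x: "x \<in> S"
  shows "f x = g x"
proof -
  have "(\<lambda>x. f x - g x) constant_on S"
  proof (rule continuous_discrete_range_constant[OF S])
    fix x assume x: "x \<in> S"
    show "\<exists>e>0. \<forall>y. y \<in> S \<and> f y - g y \<noteq> f x - g x \<longrightarrow> e \<le> norm (f y - g y - (f x - g x))"
    proof (intro exI[of _ "2 * pi"] conjI allI impI)
      fix y assume y: "y \<in> S \<and> f y - g y \<noteq> f x - g x"
      obtain m where m: "f x = g x + of_int (2 * m) * pi * \<i>" using eq[OF x] unfolding exp_eq by auto
      obtain n where n: "f y = g y + of_int (2 * n) * pi * \<i>" using eq[of y] y unfolding exp_eq by auto
      have "f y - g y - (f x - g x) = of_real (2 * pi * of_int (n - m)) * \<i>"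
        by (simp add: m n algebra_simps)
      hence "norm (f y - g y - (f x - g x)) = 2 * pi * \<bar>real_of_int (n - m)\<bar>"
        by (simp only: norm_mult norm_of_real) (simp add: abs_mult)
      moreover have "n \<noteq> m" using y m n by auto
      hence "1 \<le> \<bar>real_of_int (n - m)\<bar>" by linarith
      ultimately show "2 * pi \<le> norm (f y - g y - (f x - g x))" by simp
    qed simp
  qed (intro continuous_intros cont)
  then obtain c where "\<And>x. x \<in> S \<Longrightarrow> f x - g x = c" unfolding constant_on_def by auto
  thus ?thesis using p x by (metis eq_iff_diff_eq_0)
qed

lemma exp_bern_log:
  assumes "z \<in> ball 0 (2 * pi)"
  shows "exp (bern_log z) * (exp z - 1) = z"
proof -
  have "exp z \<noteq> 1" if "z \<noteq> 0"
    using bern_log_props(3)[of z] assms that by (metis Diff_iff div_by_0 exp_not_eq_zero right_minus_eq singletonD)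
  thus "exp (bern_log z) * (exp z - 1) = z"
    using bern_log_props(3)[of z] assms by (cases "z = 0") auto
qed

lemma continuous_on_bern_log: "continuous_on (ball 0 (2 * pi)) bern_log"
  using bern_log_props(1) by (rule holomorphic_on_imp_continuous_on)

lemma bern_log_cnj:
  assumes "z \<in> ball 0 (2 * pi)"
  shows "bern_log (cnj z) = cnj (bern_log z)"
proof -
  have "cnj (bern_log (cnj z)) = bern_log z"
  proof (rule continuous_log_unique[where S = "ball 0 (2 * pi)" and p = 0
      and f = "\<lambda>z. cnj (bern_log (cnj z))" and g = bern_log])
    show "continuous_on (ball 0 (2 * pi)) (\<lambda>z. cnj (bern_log (cnj z)))"
      by (intro continuous_intros continuous_on_compose2[OF continuous_on_bern_log]) auto
    fix x :: complex assume x: "x \<in> ball 0 (2 * pi)"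
    show "exp (cnj (bern_log (cnj x))) = exp (bern_log x)"
    proof (cases "x = 0")
      case False
      thus ?thesis using bern_log_props(3)[of x] bern_log_props(3)[of "cnj x"] x
        by (simp flip: exp_cnj)
    qed (simp add: bern_log_props(2))
  qed (use assms bern_log_props(2) continuous_on_bern_log in auto)
  thus ?thesis by (metis complex_cnj_cnj)
qed

lemma one_minus_exp_notin_nonpos_Reals:
  assumes "\<bar>Im z\<bar> < 2 * pi" "\<not> (Im z = 0 \<and> 0 \<le> Re z)"
  shows "1 - exp z \<notin> \<real>\<^sub>\<le>\<^sub>0"
proof
  assume "1 - exp z \<in> \<real>\<^sub>\<le>\<^sub>0"
  then obtain r where r: "r \<le> 0" "1 - exp z = of_real r" by (auto elim: nonpos_Reals_cases)
  hence "exp z = of_real (1 - r)" by (simp add: algebra_simps)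
  also have "\<dots> = exp (of_real (ln (1 - r)))" using r by (simp add: exp_of_real)
  finally obtain n where n: "z = of_real (ln (1 - r)) + of_int (2 * n) * pi * \<i>" unfolding exp_eq by auto
  hence "\<bar>real_of_int n\<bar> < 1" using assms(1) by (simp add: abs_mult)
  hence "n = 0" by linarith
  thus False using n assms(2) r by simp
qed

text \<open>
Both sides are logarithms of \<open>z / (exp z - 1)\<close> on the disc slit along the non-negative reals, which
is star-shaped about \<open>-1\<close>. At \<open>-1\<close> both values are real, hence equal. This is what connects the branch
normalised at \<open>0\<close> with principal powers.
\<close>
lemma bern_log_eq_Ln:
  assumes z: "norm z < 2 * pi" "\<not> (Im z = 0 \<and> 0 \<le> Re z)"
  shows "bern_log z = Ln (- z) - Ln (1 - exp z)"
proof (rule continuous_log_unique[where p = "-1" and f = bern_log and g = "\<lambda>z. Ln (- z) - Ln (1 - exp z)"])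
  define S :: "complex set" where "S = ball 0 (2 * pi) \<inter> {z. \<not> (Im z = 0 \<and> 0 \<le> Re z)}"
  have "1 < 2 * pi" using pi_gt3 by simp
  hence m1: "-1 \<in> S" unfolding S_def by simp
  have "starlike S"
    unfolding starlike_def
  proof (intro bexI[OF _ m1] ballI subsetI)
    fix x y assume x: "x \<in> S" and y: "y \<in> closed_segment (-1) x"
    have "y \<in> ball 0 (2 * pi)"
      using closed_segment_subset[of "-1" "ball 0 (2 * pi)" x] x m1 y by (auto simp: S_def)
    moreover from y obtain u where u: "0 \<le> u" "u \<le> 1" "y = (1 - u) *\<^sub>R (-1) + u *\<^sub>R x"
      by (auto simp: closed_segment_def)
    have "\<not> (Im y = 0 \<and> 0 \<le> Re y)"
    proof
      assume *: "Im y = 0 \<and> 0 \<le> Re y"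
      hence "u \<noteq> 0" using u by auto
      hence "Im x = 0" using * u by simp
      hence "Re x < 0" using x by (auto simp: S_def)
      hence "u * Re x < 0" using \<open>u \<noteq> 0\<close> u by (simp add: mult_pos_neg)
      thus False using * u by simp
    qed
    ultimately show "y \<in> S" by (simp add: S_def)
  qed
  thus "connected S" by (rule starlike_imp_connected)
  have nz: "- x \<notin> \<real>\<^sub>\<le>\<^sub>0" "1 - exp x \<notin> \<real>\<^sub>\<le>\<^sub>0" if "x \<in> S" for x
  proof -
    show "- x \<notin> \<real>\<^sub>\<le>\<^sub>0" using that by (auto simp: S_def complex_nonpos_Reals_iff)
    show "1 - exp x \<notin> \<real>\<^sub>\<le>\<^sub>0" using that abs_Im_le_cmod[of x]
      by (intro one_minus_exp_notin_nonpos_Reals) (auto simp: S_def)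
  qed
  show "continuous_on S (\<lambda>z. Ln (- z) - Ln (1 - exp z))" using nz by (intro continuous_intros) auto
  show "continuous_on S bern_log" by (rule continuous_on_subset[OF continuous_on_bern_log]) (auto simp: S_def)
  show ex: "exp (bern_log x) = exp (Ln (- x) - Ln (1 - exp x))" if "x \<in> S" for x
  proof -
    from that nz[OF that] have "x \<noteq> 0" "1 - exp x \<noteq> 0" by (auto simp: S_def)
    moreover have "exp (bern_log x) = x / (exp x - 1)"
      using that \<open>x \<noteq> 0\<close> by (intro bern_log_props) (auto simp: S_def)
    ultimately show ?thesis by (simp add: exp_diff minus_divide_left[symmetric]) (simp add: divide_simps algebra_simps)
  qed
  show "bern_log (-1) = Ln (- (-1)) - Ln (1 - exp (-1))"
  proof -
    have "bern_log (-1) \<in> \<real>" using bern_log_cnj[of "-1"] \<open>1 < 2 * pi\<close> by (simp add: Reals_cnj_iff)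
    then obtain r where r: "bern_log (-1) = of_real r" by (auto elim: Reals_cases)
    have "1 - exp (-1) = complex_of_real (1 - exp (-1))" by (simp flip: exp_of_real)
    hence e: "Ln (1 - exp (-1)) = of_real (ln (1 - exp (-1)))" by (simp add: Ln_of_real del: of_real_diff)
    have "exp (complex_of_real r) = exp (of_real (- ln (1 - exp (-1))))"
      using ex[OF m1] r e by simp
    hence "complex_of_real (exp r) = of_real (exp (- ln (1 - exp (-1))))" by (simp only: exp_of_real)
    hence "r = - ln (1 - exp (-1))" by (simp only: of_real_eq_iff exp_inj_iff)
    thus ?thesis using r e by simp
  qed
  show "-1 \<in> S" by (rule m1)
  show "z \<in> S" using z by (auto simp: S_def)
qed

text \<open>
The summand of \<open>S_sum k s\<close> at index \<open>j\<close> is \<open>root_power s (j / k)\<close>.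
\<close>
definition root_power :: "real \<Rightarrow> complex \<Rightarrow> complex" where
  "root_power s x = (1 - exp (2 * of_real pi * \<i> * x)) powr (- of_real s)"

text \<open>
The coefficients of the expansion of \<open>root_power s x\<close> at \<open>0\<close> in the powers \<open>x powr (l - s)\<close>.
\<close>
definition sing_coeff :: "real \<Rightarrow> nat \<Rightarrow> complex" where
  "sing_coeff s l = of_real ((2 * pi) powr (real l - s)) * gen_bernoulli (of_real s) l / fact l
     * cis ((real l + s) * pi / 2)"

lemma Ln_minus_ii_mult:
  assumes "0 < Re x \<or> (0 \<le> Re x \<and> 0 < Im x)"
  shows "Ln (- \<i> * x) = Ln x - \<i> * of_real (pi / 2)"
proof (rule Ln_unique)
  have x0: "x \<noteq> 0" using assms by auto
  have "exp (- \<i> * of_real (pi / 2)) = - \<i>"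
    by (metis cis_conv_exp cis_inverse cis_pi_half exp_minus mult_minus_left complex_i_mult_minus inverse_i of_real_minus mult.commute mult_minus_right inverse_eq_divide)
  moreover have "Ln x - \<i> * of_real (pi / 2) = Ln x + - \<i> * of_real (pi / 2)" by simp
  ultimately show "exp (Ln x - \<i> * of_real (pi / 2)) = - \<i> * x"
    using x0 by (simp only: exp_add) simp
  have "- (pi / 2) \<le> Im (Ln x)" "Im (Ln x) \<le> pi / 2" "Im (Ln x) \<noteq> - (pi / 2)"
    using Re_Ln_pos_le[OF x0] Re_Ln_pos_lt[OF x0] Im_Ln_pos_lt[OF x0] assms by (auto simp: abs_if split: if_splits)
  thus "- pi < Im (Ln x - \<i> * of_real (pi / 2))" "Im (Ln x - \<i> * of_real (pi / 2)) \<le> pi"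
    by auto
qed

lemma root_power_eq:
  assumes x: "0 < Re x \<or> (0 \<le> Re x \<and> 0 < Im x)" "norm x < 1"
  shows "root_power s x = of_real ((2 * pi) powr (- s)) * cis (s * pi / 2) * x powr (- of_real s)
            * exp (of_real s * bern_log (2 * of_real pi * \<i> * x))"
proof -
  define z where "z = 2 * of_real pi * \<i> * x"
  have x0: "x \<noteq> 0" using x by auto
  have nz: "norm z < 2 * pi" using x by (simp add: z_def norm_mult)
  have z: "\<not> (Im z = 0 \<and> 0 \<le> Re z)" using x by (auto simp: z_def zero_le_mult_iff mult_le_0_iff not_le[THEN iffD2, OF pi_gt_zero])
  have "\<bar>Im z\<bar> < 2 * pi" using nz abs_Im_le_cmod[of z] by linarith
  hence "1 - exp z \<notin> \<real>\<^sub>\<le>\<^sub>0" using z by (intro one_minus_exp_notin_nonpos_Reals) auto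
  hence e0: "1 - exp z \<noteq> 0" by auto
  have "- z = of_real (2 * pi) * (- \<i> * x)" by (simp add: z_def algebra_simps)
  hence "Ln (- z) = of_real (ln (2 * pi)) + (Ln x - \<i> * of_real (pi / 2))"
  proof -
    have "Ln (of_real (2 * pi) * (- \<i> * x)) = of_real (ln (2 * pi)) + Ln (- \<i> * x)"
      using x0 Ln_times_of_real[of "2 * pi" "- \<i> * x"] Ln_of_real[of "2 * pi"] by simp
    with \<open>- z = _\<close> show ?thesis by (simp only: Ln_minus_ii_mult[OF x(1)])
  qed
  hence "Ln (1 - exp z) = of_real (ln (2 * pi)) + (Ln x - \<i> * of_real (pi / 2)) - bern_log z"
    by (simp only: bern_log_eq_Ln[OF nz z]) simp
  hence "root_power s x = exp (- of_real s * (of_real (ln (2 * pi)) + (Ln x - \<i> * of_real (pi / 2)) - bern_log z))"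
    using e0 unfolding root_power_def z_def[symmetric] by (simp add: powr_def)
  also have "- of_real s * (of_real (ln (2 * pi)) + (Ln x - \<i> * of_real (pi / 2)) - bern_log z)
     = of_real (- s * ln (2 * pi)) + \<i> * of_real (s * pi / 2) + (- of_real s) * Ln x + of_real s * bern_log z"
    by (simp add: algebra_simps)
  also have "exp \<dots> = of_real ((2 * pi) powr (- s)) * cis (s * pi / 2) * x powr (- of_real s) * exp (of_real s * bern_log z)"
    using x0 unfolding exp_add by (simp add: powr_def exp_of_real cis_conv_exp del: of_real_mult of_real_minus of_real_divide)
  finally show ?thesis by (simp add: z_def)
qed

lemma power_series_coeffs_unique:
  fixes A B :: "nat \<Rightarrow> complex"
  assumes "R > 0" "\<And>z. norm z < R \<Longrightarrow> (\<lambda>l. A l * z ^ l) sums f z"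
    "\<And>z. norm z < R \<Longrightarrow> (\<lambda>l. B l * z ^ l) sums f z"
  shows "A = B"
proof -
  have E: "f has_fps_expansion Abs_fps A" if "\<And>z. norm z < R \<Longrightarrow> (\<lambda>l. A l * z ^ l) sums f z" for A
  proof (rule has_fps_expansionI)
    have "eventually (\<lambda>z. z \<in> ball 0 R) (nhds (0::complex))"
      using assms(1) by (intro eventually_nhds_in_open) auto
    thus "\<forall>\<^sub>F z in nhds 0. (\<lambda>n. fps_nth (Abs_fps A) n * z ^ n) sums f z"
      by eventually_elim (use that in auto)
  qed
  from fps_expansion_unique_complex[OF E[OF assms(2)] E[OF assms(3)]]
  show ?thesis by (simp add: fps_eq_iff fun_eq_iff)
qed

text \<open>
\<open>(z / (exp z - 1))^s\<close> commutes with complex conjugation for real \<open>s\<close>, hence so do its Taylor coefficients.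
\<close>
lemma gen_bernoulli_real: "cnj (gen_bernoulli (of_real s) l) = gen_bernoulli (of_real s) l"
proof -
  let ?b = "\<lambda>l. gen_bernoulli (of_real s) l / fact l"
  have "(\<lambda>l. cnj (?b l)) = ?b"
  proof (rule power_series_coeffs_unique[where R = "2 * pi" and f = "\<lambda>z. exp (of_real s * bern_log z)"])
    fix z :: complex assume z: "norm z < 2 * pi"
    show "(\<lambda>l. ?b l * z ^ l) sums exp (of_real s * bern_log z)" by (rule gen_bernoulli_sums[OF z])
    have "(\<lambda>l. cnj (?b l * cnj z ^ l)) sums cnj (exp (of_real s * bern_log (cnj z)))"
      unfolding sums_cnj using gen_bernoulli_sums[of "cnj z"] z by simp
    also have "cnj (exp (of_real s * bern_log (cnj z))) = exp (of_real s * bern_log z)"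
      using bern_log_cnj[of z] z by (simp add: exp_cnj)
    finally show "(\<lambda>l. cnj (?b l) * z ^ l) sums exp (of_real s * bern_log z)" by simp
  qed simp
  from fun_cong[OF this, of l] show ?thesis by simp
qed

text \<open>
\<open>beta_coeff l s\<close> is the real part of \<open>sing_coeff s l\<close>: the two ends of the summation range give complex
conjugate contributions.
\<close>
lemma beta_coeff_eq_sing_coeff: "2 * beta_coeff l s = sing_coeff s l + cnj (sing_coeff s l)"
proof -
  define c where "c = of_real ((2 * pi) powr (real l - s)) * gen_bernoulli (of_real s) l / fact l"
  have "cnj c = c" by (simp add: c_def gen_bernoulli_real)
  hence "sing_coeff s l + cnj (sing_coeff s l)
    = c * (cis ((real l + s) * pi / 2) + cnj (cis ((real l + s) * pi / 2)))"
    by (simp add: sing_coeff_def c_def algebra_simps)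
  also have "cis ((real l + s) * pi / 2) + cnj (cis ((real l + s) * pi / 2)) = 2 * of_real (cos ((real l + s) * pi / 2))"
    by (simp add: complex_eq_iff)
  finally show ?thesis by (simp add: beta_coeff_def c_def)
qed

lemma power_series_truncation:
  fixes b :: "nat \<Rightarrow> complex"
  assumes sums: "\<And>z. norm z < R \<Longrightarrow> (\<lambda>l. b l * z ^ l) sums f z" and r: "0 < r" "r < R"
  obtains C where "C \<ge> 0" "\<And>z. norm z \<le> r \<Longrightarrow> norm (f z - (\<Sum>l\<le>N. b l * z ^ l)) \<le> C * norm z ^ Suc N"
proof -
  have "norm (complex_of_real ((r + R) / 2)) < R" using r by (simp only: norm_of_real) simp
  hence "summable (\<lambda>l. b l * of_real ((r + R) / 2) ^ l)" by (rule sums_summable[OF sums])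
  hence "summable (\<lambda>l. norm (b l * of_real r ^ l))"
    by (rule powser_insidea) (use r in \<open>simp_all only: norm_of_real, simp_all\<close>)
  hence "summable (\<lambda>l. norm (b (l + Suc N) * of_real r ^ (l + Suc N)) / r ^ Suc N)"
    by (intro summable_divide summable_ignore_initial_segment)
  hence s: "summable (\<lambda>l. norm (b (l + Suc N)) * r ^ l)"
    using r by (simp add: norm_mult norm_power power_add field_simps)
  show thesis
  proof
    show "0 \<le> (\<Sum>l. norm (b (l + Suc N)) * r ^ l)" using r by (intro suminf_nonneg s) auto
    fix z :: complex assume z: "norm z \<le> r"
    have "(\<lambda>l. b (l + Suc N) * z ^ (l + Suc N)) sums (f z - (\<Sum>l<Suc N. b l * z ^ l))"
      using sums_split_initial_segment[OF sums[of z], of "Suc N"] z r by simp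
    hence eq: "f z - (\<Sum>l\<le>N. b l * z ^ l) = (\<Sum>l. b (l + Suc N) * z ^ (l + Suc N))"
      by (simp add: sums_iff lessThan_Suc_atMost)
    have le: "norm (b (l + Suc N) * z ^ (l + Suc N)) \<le> norm (b (l + Suc N)) * r ^ l * norm z ^ Suc N" for l
    proof -
      have "norm (b (l + Suc N) * z ^ (l + Suc N)) = norm (b (l + Suc N)) * norm z ^ l * norm z ^ Suc N"
        by (simp add: norm_mult norm_power power_add)
      also have "\<dots> \<le> norm (b (l + Suc N)) * r ^ l * norm z ^ Suc N"
        using z by (intro mult_right_mono mult_left_mono power_mono) auto
      finally show ?thesis .
    qed
    have "norm (\<Sum>l. b (l + Suc N) * z ^ (l + Suc N)) \<le> (\<Sum>l. norm (b (l + Suc N)) * r ^ l * norm z ^ Suc N)"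
      by (rule norm_suminf_le[OF le summable_mult2[OF s]])
    also have "\<dots> = (\<Sum>l. norm (b (l + Suc N)) * r ^ l) * norm z ^ Suc N"
      by (rule suminf_mult2[OF s, symmetric])
    finally show "norm (f z - (\<Sum>l\<le>N. b l * z ^ l)) \<le> (\<Sum>l. norm (b (l + Suc N)) * r ^ l) * norm z ^ Suc N"
      by (simp only: eq)
  qed
qed

text \<open>
Multiply the Taylor expansion of \<open>(z / (exp z - 1))^s\<close>, \<open>z = 2 * pi * \<i> * x\<close>, by the principal power
\<open>(-z) powr (-s)\<close>. The estimate holds up to the positive imaginary axis.
\<close>
lemma root_power_expansion:
  obtains C where "C \<ge> 0"
    "\<And>x. 0 < Re x \<or> (0 \<le> Re x \<and> 0 < Im x) \<Longrightarrow> norm x \<le> 1 / 2 \<Longrightarrow>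
       norm (root_power s x - (\<Sum>l\<le>N. sing_coeff s l * x powr of_real (real l - s)))
         \<le> C * norm x powr (real (Suc N) - s)"
proof -
  let ?b = "\<lambda>l. gen_bernoulli (of_real s) l / fact l"
  obtain C where C: "C \<ge> 0" "\<And>z. norm z \<le> pi \<Longrightarrow>
      norm (exp (of_real s * bern_log z) - (\<Sum>l\<le>N. ?b l * z ^ l)) \<le> C * norm z ^ Suc N"
    using power_series_truncation[of "2 * pi" ?b "\<lambda>z. exp (of_real s * bern_log z)" pi N, OF gen_bernoulli_sums] by auto
  show thesis
  proof
    show "(2 * pi) powr (- s) * C * (2 * pi) ^ Suc N \<ge> 0" using C by simp
    fix x :: complex assume x: "0 < Re x \<or> (0 \<le> Re x \<and> 0 < Im x)" "norm x \<le> 1 / 2"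
    have x0: "x \<noteq> 0" using x by auto
    define z where "z = 2 * of_real pi * \<i> * x"
    define p where "p = of_real ((2 * pi) powr (- s)) * cis (s * pi / 2) * x powr (- of_real s)"
    have "p * (?b l * z ^ l) = sing_coeff s l * x powr of_real (real l - s)" for l
    proof -
      have "x powr of_real (real l - s) = x powr (of_nat l - of_real s)" by simp
      also have "\<dots> = x ^ l * x powr (- of_real s)"
        using x0 by (simp only: diff_conv_add_uminus powr_add powr_nat) simp
      finally have 1: "x powr of_real (real l - s) = x ^ l * x powr (- of_real s)" .
      have "(2 * pi) powr (real l - s) = (2 * pi) ^ l * (2 * pi) powr (- s)"
        by (simp only: diff_conv_add_uminus powr_add) (simp add: powr_realpow)
      hence 2: "complex_of_real ((2 * pi) powr (real l - s)) = (2 * of_real pi) ^ l * of_real ((2 * pi) powr (- s))" by simp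
      have "cis ((real l + s) * pi / 2) = cis (real l * (pi / 2)) * cis (s * pi / 2)"
        by (simp add: cis_mult algebra_simps add_divide_distrib)
      also have "cis (real l * (pi / 2)) = \<i> ^ l"
        by (simp only: Complex.DeMoivre[symmetric] cis_pi_half)
      finally have 3: "cis ((real l + s) * pi / 2) = \<i> ^ l * cis (s * pi / 2)" .
      show ?thesis unfolding p_def sing_coeff_def z_def 1 2 3 by (simp add: power_mult_distrib)
    qed
    hence sum: "(\<Sum>l\<le>N. sing_coeff s l * x powr of_real (real l - s)) = p * (\<Sum>l\<le>N. ?b l * z ^ l)"
      by (simp add: sum_distrib_left)
    have "root_power s x = p * exp (of_real s * bern_log z)"
      using root_power_eq[of x s] x by (simp add: p_def z_def)
    hence "root_power s x - (\<Sum>l\<le>N. sing_coeff s l * x powr of_real (real l - s))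
       = p * (exp (of_real s * bern_log z) - (\<Sum>l\<le>N. ?b l * z ^ l))"
      unfolding sum by (simp add: algebra_simps)
    also have "norm \<dots> \<le> ((2 * pi) powr (- s) * norm x powr (- s)) * (C * (2 * pi * norm x) ^ Suc N)"
      unfolding norm_mult
    proof (intro mult_mono)
      show "norm p \<le> (2 * pi) powr (- s) * norm x powr (- s)"
        using norm_powr_le[OF x0, of "- of_real s"] by (simp add: p_def norm_mult)
      show "norm (exp (of_real s * bern_log z) - (\<Sum>l\<le>N. ?b l * z ^ l)) \<le> C * (2 * pi * norm x) ^ Suc N"
        using C(2)[of z] x by (simp add: z_def norm_mult)
    qed auto
    also have "\<dots> = (2 * pi) powr (- s) * C * (2 * pi) ^ Suc N * (norm x ^ Suc N * norm x powr (- s))"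
      by (simp only: power_mult_distrib) (simp add: algebra_simps)
    also have "norm x ^ Suc N * norm x powr (- s) = norm x powr (real (Suc N) - s)"
      using x0 by (simp only: diff_conv_add_uminus powr_add) (simp add: powr_realpow del: of_nat_Suc power_Suc)
    finally show "norm (root_power s x - (\<Sum>l\<le>N. sing_coeff s l * x powr of_real (real l - s)))
       \<le> (2 * pi) powr (- s) * C * (2 * pi) ^ Suc N * norm x powr (real (Suc N) - s)" .
  qed
qed

text \<open>
This is the residue at \<open>0\<close> of \<open>(exp z - 1) powi (- Suc n)\<close>. The derivative of \<open>(exp z - 1) powi (- m)\<close> is
\<open>- m\<close> times the sum of the powers with exponents \<open>- m\<close> and \<open>- m - 1\<close>, and a derivative has no residue, so
consecutive residues are opposite. In terms of \<open>F m = (z / (exp z - 1)) ^ m\<close> this is a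
comparison of coefficients in a differential equation.
\<close>
lemma gen_bernoulli_diagonal:
  "gen_bernoulli (of_nat (Suc n)) n / fact n = (-1) ^ n"
proof -
  define F where "F = (\<lambda>m z. exp (of_nat m * bern_log z))"
  define B where "B = (\<lambda>m. Abs_fps (\<lambda>l. gen_bernoulli (of_nat m) l / fact l))"
  have nh: "eventually (\<lambda>z. z \<in> ball 0 (2 * pi)) (nhds (0::complex))"
    by (rule eventually_nhds_in_open) auto
  have E: "F m has_fps_expansion B m" for m
    by (rule has_fps_expansionI, rule eventually_mono[OF nh])
       (use gen_bernoulli_sums in \<open>auto simp: F_def B_def\<close>)
  have ode: "z * deriv (F m) z = of_nat m * (1 - z) * F m z - of_nat m * F (Suc m) z"
    if z: "z \<in> ball 0 (2 * pi)" for z m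
  proof -
    define L' where "L' = deriv bern_log z"
    have L': "(bern_log has_field_derivative L') (at z)"
      unfolding L'_def by (rule holomorphic_derivI[OF bern_log_props(1) _ z]) simp
    have "((\<lambda>z. exp (bern_log z) * (exp z - 1)) has_field_derivative
        (exp (bern_log z) * L' * (exp z - 1) + exp (bern_log z) * exp z)) (at z)"
      by (auto intro!: derivative_eq_intros L' simp: algebra_simps)
    moreover have "((\<lambda>z. exp (bern_log z) * (exp z - 1)) has_field_derivative 1) (at z)"
      by (rule has_field_derivative_transform_within_open[OF DERIV_ident _ z])
         (use exp_bern_log in auto)
    ultimately have "exp (bern_log z) * (exp z - 1) * L' + (exp (bern_log z) * (exp z - 1) + exp (bern_log z)) = 1"
      using DERIV_unique by (force simp: algebra_simps)
    hence 1: "z * L' = 1 - z - exp (bern_log z)" unfolding exp_bern_log[OF z] by (simp add: algebra_simps)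
    have "(F m has_field_derivative of_nat m * L' * F m z) (at z)"
      unfolding F_def by (auto intro!: derivative_eq_intros L')
    hence "z * deriv (F m) z = of_nat m * (z * L') * F m z" by (simp add: DERIV_imp_deriv)
    also have "\<dots> = of_nat m * (1 - z) * F m z - of_nat m * F (Suc m) z"
      unfolding 1 F_def by (simp add: algebra_simps exp_add)
    finally show ?thesis .
  qed
  have fps: "fps_X * fps_deriv (B m) = fps_const (of_nat m) * (1 - fps_X) * B m - fps_const (of_nat m) * B (Suc m)" for m
  proof (rule fps_expansion_unique_complex)
    show "(\<lambda>z. z * deriv (F m) z) has_fps_expansion fps_X * fps_deriv (B m)"
      by (intro fps_expansion_intros E)
    have "(\<lambda>z. of_nat m * (1 - z) * F m z - of_nat m * F (Suc m) z) has_fps_expansion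
      (fps_const (of_nat m) * (1 - fps_X) * B m - fps_const (of_nat m) * B (Suc m))"
      by (intro fps_expansion_intros E)
    thus "(\<lambda>z. z * deriv (F m) z) has_fps_expansion
      (fps_const (of_nat m) * (1 - fps_X) * B m - fps_const (of_nat m) * B (Suc m))"
      by (rule has_fps_expansion_cong[THEN iffD1, rotated -1])
         (use eventually_mono[OF nh] ode in auto)
  qed
  have step: "fps_nth (B (Suc (Suc n))) (Suc n) = - fps_nth (B (Suc n)) n" for n
  proof -
    have "fps_nth (fps_X * fps_deriv (B (Suc n))) (Suc n)
        = fps_nth (fps_const (of_nat (Suc n)) * (1 - fps_X) * B (Suc n) - fps_const (of_nat (Suc n)) * B (Suc (Suc n))) (Suc n)"
      by (simp only: fps)
    hence "of_nat (Suc n) * fps_nth (B (Suc n)) (Suc n)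
       = of_nat (Suc n) * (fps_nth (B (Suc n)) (Suc n) - fps_nth (B (Suc n)) n - fps_nth (B (Suc (Suc n))) (Suc n))"
      by (simp add: mult.assoc left_diff_distrib algebra_simps del: of_nat_Suc)
    hence "fps_nth (B (Suc n)) (Suc n) = fps_nth (B (Suc n)) (Suc n) - fps_nth (B (Suc n)) n - fps_nth (B (Suc (Suc n))) (Suc n)"
      by (simp only: mult_cancel_left) (simp del: of_nat_Suc)
    hence "fps_nth (B (Suc n)) n + fps_nth (B (Suc (Suc n))) (Suc n) = 0" by (simp add: algebra_simps)
    thus ?thesis by (metis add.commute eq_neg_iff_add_eq_0)
  qed
  have "fps_nth (B (Suc n)) n = (-1) ^ n"
  proof (induction n)
    case 0
    have "fps_nth (B (Suc 0)) 0 = F (Suc 0) 0" using has_fps_expansion_imp_0_eq_fps_nth_0[OF E] by metis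
    thus ?case by (simp add: F_def bern_log_props(2))
  qed (simp add: step)
  thus ?thesis by (simp add: B_def)
qed

text \<open>
For a positive integer exponent the expansion contains the power \<open>x powr (-1)\<close>. Its coefficient is purely
imaginary and independent of the exponent.
\<close>
lemma sing_coeff_residue: "sing_coeff (real (Suc n)) n = \<i> / (2 * of_real pi)"
proof -
  have "cis ((real n + real (Suc n)) * pi / 2) = cis (real n * pi + pi / 2)"
    by (rule arg_cong[of _ _ cis]) (simp add: field_simps)
  also have "\<dots> = (-1) ^ n * \<i>"
    by (simp only: cis_mult[symmetric] Complex.DeMoivre[symmetric] cis_pi cis_pi_half)
  finally have cis: "cis ((real n + real (Suc n)) * pi / 2) = (-1) ^ n * \<i>" .
  have "sing_coeff (real (Suc n)) n = of_real ((2 * pi) powr (real n - real (Suc n)))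
      * (gen_bernoulli (of_nat (Suc n)) n / fact n) * cis ((real n + real (Suc n)) * pi / 2)"
    unfolding sing_coeff_def by (simp del: of_nat_Suc)
  also have "\<dots> = of_real ((2 * pi) powr (-1)) * ((-1) ^ n * ((-1) ^ n * \<i>))"
    unfolding cis gen_bernoulli_diagonal by (simp add: mult.assoc)
  also have "(-1) ^ n * ((-1) ^ n * \<i>) = \<i>" by (rule left_minus_one_mult_self)
  also have "(2 * pi) powr (-1) = 1 / (2 * pi)" by (simp add: powr_minus_divide)
  finally show ?thesis by simp
qed

section \<open>The integral over a period\<close>

text \<open>
A star-shaped domain on which the base \<open>1 - exp (2 * pi * \<i> * x)\<close> avoids the branch cut.
\<close>
definition upper_strip :: "complex set" where
  "upper_strip = {x. 0 < Im x \<or> (0 < Re x \<and> Re x < 1)}"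

lemma open_upper_strip: "open upper_strip"
proof -
  have eq: "upper_strip = {x. 0 < Im x} \<union> ({x. 0 < Re x} \<inter> {x. Re x < 1})"
    by (auto simp: upper_strip_def)
  show ?thesis unfolding eq
    by (intro open_Un open_Int open_halfspace_Im_gt open_halfspace_Re_gt open_halfspace_Re_lt)
qed

lemma root_power_base_notin_nonpos_Reals:
  assumes "x \<in> upper_strip"
  shows "1 - exp (2 * of_real pi * \<i> * x) \<notin> \<real>\<^sub>\<le>\<^sub>0"
proof (cases "0 < Im x")
  case True
  have "Re (exp (2 * of_real pi * \<i> * x)) \<le> norm (exp (2 * of_real pi * \<i> * x))" by (rule complex_Re_le_cmod)
  also have "\<dots> < 1" using True by (simp add: norm_exp_eq_Re)
  finally show ?thesis by (auto simp: complex_nonpos_Reals_iff)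
next
  case False
  hence "0 < Re x" "Re x < 1" using assms by (auto simp: upper_strip_def)
  thus ?thesis by (intro one_minus_exp_notin_nonpos_Reals) auto
qed

lemma holomorphic_root_power: "root_power s holomorphic_on upper_strip"
  unfolding root_power_def using root_power_base_notin_nonpos_Reals by (intro holomorphic_intros) auto

lemma continuous_on_root_power: "A \<subseteq> upper_strip \<Longrightarrow> continuous_on A (root_power s)"
  using holomorphic_on_imp_continuous_on[OF holomorphic_root_power] by (rule continuous_on_subset)

text \<open>
The reflection \<open>x \<mapsto> 1 - cnj x\<close> exchanges the two ends of the summation range; it conjugates the
base, and off the branch cut also the principal power.
\<close>
lemma root_power_reflect:
  assumes "x \<in> upper_strip"
  shows "root_power s (1 - cnj x) = cnj (root_power s x)"
proof -
  have "exp (2 * of_real pi * \<i> * (1 - cnj x)) = exp (2 * of_real pi * \<i>) * exp (cnj (2 * of_real pi * \<i> * x))"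
  proof -
    have "2 * of_real pi * \<i> * (1 - cnj x) = 2 * of_real pi * \<i> + cnj (2 * of_real pi * \<i> * x)"
      by (simp add: algebra_simps)
    thus ?thesis by (simp only: exp_add)
  qed
  also have "\<dots> = cnj (exp (2 * of_real pi * \<i> * x))" by (simp only: exp_two_pi_i exp_cnj) simp
  finally have "1 - exp (2 * of_real pi * \<i> * (1 - cnj x)) = cnj (1 - exp (2 * of_real pi * \<i> * x))" by simp
  hence "root_power s (1 - cnj x) = cnj (1 - exp (2 * of_real pi * \<i> * x)) powr cnj (- of_real s)"
    by (simp add: root_power_def)
  also have "\<dots> = cnj (root_power s x)"
    unfolding root_power_def
  proof (rule cnj_powr[symmetric])
    show "0 \<le> Re (1 - exp (2 * of_real pi * \<i> * x))" if "Im (1 - exp (2 * of_real pi * \<i> * x)) = 0"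
      using root_power_base_notin_nonpos_Reals[OF assms] that by (auto simp: complex_nonpos_Reals_iff)
  qed
  finally show ?thesis .
qed

lemma norm_powr_of_real:
  fixes y :: complex
  assumes "y \<noteq> 0"
  shows "norm (y powr of_real r) = norm y powr r"
  using assms by (simp add: powr_def norm_exp_eq_Re Re_Ln)

text \<open>
For real \<open>s\<close> the size of the power depends only on the modulus of its base, so the branch cut does
no harm below the real axis.
\<close>
lemma root_power_bounded_on_lines:
  obtains M where "M \<ge> 0" "\<And>x. \<bar>Im x\<bar> = 1 / 4 \<Longrightarrow> norm (root_power s x) \<le> M"
proof
  define lo hi where "lo = 1 - exp (- pi / 2)" and "hi = 1 + exp (pi / 2)"
  have lo: "0 < lo" by (simp add: lo_def)
  show "lo powr (-s) + hi powr (-s) \<ge> 0" by simp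
  fix x :: complex assume x: "\<bar>Im x\<bar> = 1 / 4"
  define w where "w = 1 - exp (2 * of_real pi * \<i> * x)"
  define E where "E = exp (- 2 * pi * Im x)"
  have n: "norm (exp (2 * of_real pi * \<i> * x)) = E" by (simp add: norm_exp_eq_Re E_def)
  have "exp (- pi / 2) * exp (pi / 2) = 1" by (simp flip: exp_add)
  moreover have "0 \<le> (exp (pi / 2) - 1) * (1 - exp (- pi / 2))" by simp
  ultimately have cosh: "2 \<le> exp (pi / 2) + exp (- pi / 2)" by (simp add: algebra_simps)
  have "Im x = 1/4 \<or> Im x = -1/4" using x by linarith
  hence e: "E = exp (- pi / 2) \<or> E = exp (pi / 2)" by (auto simp: E_def)
  have "exp (- pi / 2) \<le> exp (pi / 2)" by simp
  hence "E \<le> exp (pi / 2)" using e by linarith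
  hence "norm w \<le> hi"
    using norm_triangle_ineq4[of 1 "exp (2 * of_real pi * \<i> * x)"] unfolding w_def hi_def n by simp
  moreover have "lo \<le> norm w"
    using norm_triangle_ineq2[of 1 "exp (2 * of_real pi * \<i> * x)"]
      norm_triangle_ineq2[of "exp (2 * of_real pi * \<i> * x)" 1] e cosh
    unfolding w_def lo_def n by (auto simp: norm_minus_commute)
  ultimately have "norm w powr (-s) \<le> lo powr (-s) \<or> norm w powr (-s) \<le> hi powr (-s)"
    using lo by (cases "s \<ge> 0") (auto intro: powr_mono2 powr_mono2')
  hence "norm w powr (-s) \<le> lo powr (-s) + hi powr (-s)"
    using powr_ge_zero[of lo "-s"] powr_ge_zero[of hi "-s"] by linarith
  moreover have "w \<noteq> 0" using \<open>lo \<le> norm w\<close> lo by auto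
  ultimately show "norm (root_power s x) \<le> lo powr (-s) + hi powr (-s)"
    using norm_powr_of_real[of w "-s"] by (simp add: root_power_def w_def)
qed

text \<open>
In the upper half-plane \<open>root_power s\<close> is a holomorphic function of \<open>w = exp (2 * pi * \<i> * x)\<close> on the unit
disc with value \<open>1\<close> at \<open>w = 0\<close>. The integral over a period is its mean value over a circle. This is the
source of the term \<open>k\<close> of the asymptotic expansion.
\<close>
lemma root_power_mean_value:
  assumes "\<delta> > 0"
  shows "contour_integral (linepath (\<i> * of_real \<delta>) (1 + \<i> * of_real \<delta>)) (root_power s) = 1"
proof -
  define r where "r = exp (- 2 * pi * \<delta>)"
  have r: "0 < r" "r < 1" using assms by (simp_all add: r_def)
  define h where "h = (\<lambda>w. (1 - w) powr (- of_real s :: complex))"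
  have "1 - w \<notin> \<real>\<^sub>\<le>\<^sub>0" if "norm w < 1" for w :: complex
    using complex_Re_le_cmod[of w] that by (auto simp: complex_nonpos_Reals_iff)
  hence hol: "h holomorphic_on ball 0 1"
    unfolding h_def by (intro holomorphic_intros) auto
  have "cball 0 r \<subseteq> ball (0::complex) 1" using r by auto
  hence "((\<lambda>w. h w / (w - 0)) has_contour_integral 2 * of_real pi * \<i> * h 0) (circlepath 0 r)"
    using r by (intro Cauchy_integral_circlepath_simple holomorphic_on_subset[OF hol]) auto
  hence "2 * of_real pi * \<i> * h 0 = contour_integral (circlepath 0 r) (\<lambda>w. h w / w)"
    by (simp add: contour_integral_unique)
  also have "\<dots> = integral {0..1} (\<lambda>t. 2 * of_real pi * \<i> * root_power s (\<i> * of_real \<delta> + of_real t))"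
    unfolding contour_integral_integral
  proof (rule integral_cong)
    fix t :: real
    have "circlepath 0 r t = exp (2 * of_real pi * \<i> * (\<i> * of_real \<delta> + of_real t))"
      by (simp add: circlepath r_def algebra_simps exp_add exp_of_real[symmetric])
         (simp flip: exp_add)
    moreover have "vector_derivative (circlepath 0 r) (at t) = 2 * of_real pi * \<i> * circlepath 0 r t"
      unfolding vector_derivative_circlepath by (simp add: circlepath)
    ultimately show "h (circlepath 0 r t) / circlepath 0 r t * vector_derivative (circlepath 0 r) (at t)
       = 2 * of_real pi * \<i> * root_power s (\<i> * of_real \<delta> + of_real t)"
      by (simp only:) (simp add: h_def root_power_def)
  qed
  also have "\<dots> = 2 * of_real pi * \<i> * contour_integral (linepath (\<i> * of_real \<delta>) (1 + \<i> * of_real \<delta>)) (root_power s)"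
    unfolding contour_integral_integral by (simp add: linepath_def algebra_simps scaleR_conv_of_real)
  finally show ?thesis by (simp add: h_def)
qed

lemma contour_integral_root_power_reflect:
  assumes "closed_segment a b \<subseteq> upper_strip"
  shows "contour_integral (linepath (1 - cnj a) (1 - cnj b)) (root_power s)
       = - cnj (contour_integral (linepath a b) (root_power s))"
proof -
  have lp: "linepath (1 - cnj a) (1 - cnj b) t = 1 - cnj (linepath a b t)" for t
    by (simp add: linepath_def algebra_simps scaleR_conv_of_real)
  have "contour_integral (linepath (1 - cnj a) (1 - cnj b)) (root_power s)
     = integral {0..1} (\<lambda>t. - cnj (root_power s (linepath a b t) * (b - a)))"
    unfolding contour_integral_integral
  proof (rule integral_cong)
    fix t :: real assume "t \<in> {0..1}"
    hence "linepath a b t \<in> upper_strip" using assms linepath_in_path by blast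
    thus "root_power s (linepath (1 - cnj a) (1 - cnj b) t) * vector_derivative (linepath (1 - cnj a) (1 - cnj b)) (at t)
      = - cnj (root_power s (linepath a b t) * (b - a))"
      by (simp only: vector_derivative_linepath_at, simp only: lp root_power_reflect) (simp add: algebra_simps)
  qed
  also have "\<dots> = - cnj (integral {0..1} (\<lambda>t. root_power s (linepath a b t) * (b - a)))"
    by (simp only: integral_neg integral_cnj)
  finally show ?thesis by (simp only: contour_integral_integral vector_derivative_linepath_at)
qed

text \<open>
Cauchy's theorem on the trapezium with vertices \<open>\<delta>\<close>, \<open>1 - \<delta>\<close>, \<open>1 + \<i> * \<delta>\<close>, \<open>\<i> * \<delta>\<close>: the top side
contributes a full period, the slanted sides are exchanged by the reflection.
\<close>
lemma root_power_integral:
  fixes s \<delta> :: real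
  assumes d: "0 < \<delta>" "\<delta> < 1 / 2"
  defines "X \<equiv> contour_integral (linepath (\<i> * of_real \<delta>) (of_real \<delta>)) (root_power s)"
  shows "contour_integral (linepath (of_real \<delta>) (of_real (1 - \<delta>))) (root_power s) = 1 - (X + cnj X)"
proof -
  have star: "starlike upper_strip"
    unfolding starlike_def
  proof (intro bexI[of _ "1 / 2 + \<i>"] ballI)
    fix x assume x: "x \<in> upper_strip"
    have c1: "convex {x. 0 < Im x}" by (rule convex_halfspace_Im_gt)
    have c2: "convex ({x. 0 < Re x} \<inter> {x. Re x < 1})"
      by (intro convex_Int convex_halfspace_Re_gt convex_halfspace_Re_lt)
    show "closed_segment (1 / 2 + \<i>) x \<subseteq> upper_strip"
    proof (cases "0 < Im x")
      case True
      hence "closed_segment (1 / 2 + \<i>) x \<subseteq> {x. 0 < Im x}" by (intro closed_segment_subset c1) auto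
      thus ?thesis by (auto simp: upper_strip_def)
    next
      case False
      hence "closed_segment (1 / 2 + \<i>) x \<subseteq> {x. 0 < Re x} \<inter> {x. Re x < 1}"
        using x by (intro closed_segment_subset c2) (auto simp: upper_strip_def)
      thus ?thesis by (auto simp: upper_strip_def)
    qed
  qed (simp add: upper_strip_def)
  let ?a = "complex_of_real \<delta>" and ?b = "complex_of_real (1 - \<delta>)" and ?c = "1 + \<i> * complex_of_real \<delta>" and ?d = "\<i> * complex_of_real \<delta>"
  have ab: "closed_segment ?a ?b \<subseteq> upper_strip"
  proof -
    have "closed_segment ?a ?b \<subseteq> {x. 0 < Re x} \<inter> {x. Re x < 1}"
      using d by (intro closed_segment_subset convex_Int convex_halfspace_Re_gt convex_halfspace_Re_lt) auto
    thus ?thesis by (auto simp: upper_strip_def)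
  qed
  have da: "closed_segment ?d ?a \<subseteq> upper_strip"
  proof
    fix x assume "x \<in> closed_segment ?d ?a"
    then obtain u where u: "0 \<le> u" "u \<le> 1" "x = (1 - u) *\<^sub>R ?d + u *\<^sub>R ?a" by (auto simp: closed_segment_def)
    have "Re x = u * \<delta>" "Im x = (1 - u) * \<delta>" unfolding u(3) by simp_all
    thus "x \<in> upper_strip" using u d by (cases "u = 1") (auto simp: upper_strip_def)
  qed
  have bc: "closed_segment ?b ?c \<subseteq> upper_strip"
  proof
    fix x assume "x \<in> closed_segment ?b ?c"
    then obtain u where u: "0 \<le> u" "u \<le> 1" "x = (1 - u) *\<^sub>R ?b + u *\<^sub>R ?c" by (auto simp: closed_segment_def)
    have "Re x = (1 - u) * (1 - \<delta>) + u" "Im x = u * \<delta>" unfolding u(3) by simp_all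
    thus "x \<in> upper_strip" using u d by (cases "u = 0") (auto simp: upper_strip_def)
  qed
  have cd: "closed_segment ?c ?d \<subseteq> upper_strip"
  proof -
    have "closed_segment ?c ?d \<subseteq> {x. 0 < Im x}"
      using d by (intro closed_segment_subset convex_halfspace_Im_gt) auto
    thus ?thesis by (auto simp: upper_strip_def)
  qed
  note int = contour_integrable_continuous_linepath[OF continuous_on_root_power]
  have "(root_power s has_contour_integral 0) (linepath ?a ?b +++ linepath ?b ?c +++ linepath ?c ?d +++ linepath ?d ?a)"
    by (rule Cauchy_theorem_starlike_simple[OF open_upper_strip star holomorphic_root_power])
       (use ab bc cd da in \<open>auto simp: path_image_join valid_path_join\<close>)
  from contour_integral_unique[OF this]
  have "contour_integral (linepath ?a ?b) (root_power s) + contour_integral (linepath ?b ?c) (root_power s)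
     + contour_integral (linepath ?c ?d) (root_power s) + X = 0"
    using int[OF ab] int[OF bc] int[OF cd] int[OF da] by (simp add: X_def add.assoc)
  moreover have "contour_integral (linepath ?c ?d) (root_power s) = -1"
    using root_power_mean_value[OF d(1), of s]
      contour_integral_reverse_linepath[OF continuous_on_root_power[OF cd], of s] by simp
  moreover have "contour_integral (linepath ?b ?c) (root_power s) = cnj X"
  proof -
    have ad: "closed_segment ?a ?d \<subseteq> upper_strip" using da by (simp add: closed_segment_commute)
    have "contour_integral (linepath ?b ?c) (root_power s) = - cnj (contour_integral (linepath ?a ?d) (root_power s))"
      using contour_integral_root_power_reflect[OF ad, of s] by simp
    also have "contour_integral (linepath ?a ?d) (root_power s) = - X"
      unfolding X_def by (rule contour_integral_reverse_linepath[OF continuous_on_root_power[OF ad]])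
    finally show ?thesis by simp
  qed
  ultimately show ?thesis by (simp add: algebra_simps eq_neg_iff_add_eq_0)
qed

section \<open>The two ingredients of the Abel--Plana formula\<close>

lemma chord_points:
  assumes "\<delta> > 0" "x \<in> closed_segment (\<i> * of_real \<delta>) (of_real \<delta>)"
  shows "0 < Re x \<or> (0 \<le> Re x \<and> 0 < Im x)" "x \<notin> \<real>\<^sub>\<le>\<^sub>0"
    "\<delta> / 2 \<le> norm x" "norm x \<le> \<delta>" "x \<in> upper_strip \<or> 1 \<le> \<delta>"
proof -
  from assms(2) obtain u where u: "0 \<le> u" "u \<le> 1" "x = (1 - u) *\<^sub>R (\<i> * of_real \<delta>) + u *\<^sub>R of_real \<delta>"
    by (auto simp: closed_segment_def)
  have x: "Re x = u * \<delta>" "Im x = (1 - u) * \<delta>" unfolding u(3) by simp_all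
  have nn: "0 \<le> Re x" "0 \<le> Im x" using u assms(1) by (simp_all add: x)
  have sum: "Re x + Im x = \<delta>" by (simp add: x algebra_simps)
  thus "0 < Re x \<or> (0 \<le> Re x \<and> 0 < Im x)" using nn assms(1) by linarith
  show "norm x \<le> \<delta>" using cmod_le[of x] nn sum by simp
  show "\<delta> / 2 \<le> norm x" using complex_Re_le_cmod[of x] abs_Im_le_cmod[of x] nn sum by linarith
  show "x \<in> upper_strip \<or> 1 \<le> \<delta>" using nn sum assms(1) by (auto simp: upper_strip_def)
  show "x \<notin> \<real>\<^sub>\<le>\<^sub>0" using nn sum assms(1) by (auto simp: complex_nonpos_Reals_iff)
qed

text \<open>
Integrating one term of the expansion from \<open>\<i> * \<delta>\<close> to \<open>\<delta>\<close>. The primitive at \<open>\<i> * \<delta>\<close> is purely imaginary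
after multiplication by the coefficient, so it drops out of the real part. Only the power \<open>x powr (-1)\<close> has
a logarithm as primitive; it contributes \<open>1/2\<close> whatever \<open>\<delta>\<close> is, which is why the main term is \<open>k/2\<close>
for positive integers \<open>s\<close>.
\<close>
lemma sing_coeff_chord_integral:
  fixes s \<delta> :: real and l :: nat
  assumes d: "\<delta> > 0"
  defines "P \<equiv> sing_coeff s l * contour_integral (linepath (\<i> * of_real \<delta>) (of_real \<delta>)) (\<lambda>x. x powr of_real (real l - s))"
  shows "P + cnj P = (if s = real l + 1 then 1 / 2
     else 2 * beta_coeff l s * of_real (\<delta> powr (real l - s + 1) / (real l - s + 1)))"
proof (cases "s = real l + 1")
  case True
  hence s: "s = real (Suc l)" by simp
  have "((\<lambda>x. x powr of_real (real l - s)) has_contour_integral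
     (Ln (pathfinish (linepath (\<i> * of_real \<delta>) (of_real \<delta>))) - Ln (pathstart (linepath (\<i> * of_real \<delta>) (of_real \<delta>)))))
     (linepath (\<i> * of_real \<delta>) (of_real \<delta>))"
  proof (rule contour_integral_primitive[where S = "closed_segment (\<i> * of_real \<delta>) (of_real \<delta>)"])
    fix x :: complex assume x: "x \<in> closed_segment (\<i> * of_real \<delta>) (of_real \<delta>)"
    have "x \<noteq> 0" using chord_points(2)[OF d x] by auto
    thus "(Ln has_field_derivative x powr of_real (real l - s)) (at x within closed_segment (\<i> * of_real \<delta>) (of_real \<delta>))"
      using chord_points(2)[OF d x] True
      by (auto intro!: derivative_eq_intros simp: powr_minus field_simps)
  qed auto
  moreover have "Ln (\<i> * of_real \<delta>) = of_real (ln \<delta>) + \<i> * of_real (pi / 2)"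
    using Ln_times_of_real[OF d, of \<i>] d by (simp add: mult.commute Ln_of_real)
  ultimately have "contour_integral (linepath (\<i> * of_real \<delta>) (of_real \<delta>)) (\<lambda>x. x powr of_real (real l - s)) = - \<i> * of_real (pi / 2)"
    using d by (simp add: contour_integral_unique Ln_of_real)
  hence "P = \<i> / (2 * of_real pi) * (- \<i> * of_real (pi / 2))"
    unfolding P_def by (simp only: s sing_coeff_residue)
  also have "\<dots> = 1 / 4" by simp
  finally have P: "P = 1 / 4" .
  show ?thesis unfolding P using True by simp
next
  case False
  define r where "r = real l - s + 1"
  have r: "r \<noteq> 0" "of_real (real l - s) \<noteq> (-1 :: complex)" using False
    by (auto simp: r_def complex_eq_iff)
  have rr: "of_real (real l - s) + 1 = complex_of_real r" by (simp add: r_def)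
  define D where "D = of_real ((2 * pi) powr (real l - s)) * gen_bernoulli (of_real s) l / fact l"
  have D: "cnj D = D" by (simp add: D_def gen_bernoulli_real)
  have c: "sing_coeff s l = D * cis ((real l + s) * pi / 2)" by (simp add: sing_coeff_def D_def)
  have int: "contour_integral (linepath (\<i> * of_real \<delta>) (of_real \<delta>)) (\<lambda>x. x powr of_real (real l - s))
    = (of_real \<delta> powr of_real r - (\<i> * of_real \<delta>) powr of_real r) / of_real r"
    unfolding rr[symmetric]
    by (rule contour_integral_powr_linepath) (use r chord_points(2)[OF d] in auto)
  have "Ln (\<i> * of_real \<delta>) = of_real (ln \<delta>) + \<i> * of_real (pi / 2)"
    using Ln_times_of_real[OF d, of \<i>] d by (simp add: mult.commute Ln_of_real)
  hence "(\<i> * of_real \<delta>) powr of_real r = exp (of_real (r * ln \<delta>) + \<i> * of_real (r * pi / 2))"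
    using d by (simp add: powr_def algebra_simps)
  also have "\<dots> = of_real (\<delta> powr r) * cis (r * pi / 2)"
    unfolding exp_add exp_of_real using d by (simp add: powr_def cis_conv_exp)
  finally have i: "(\<i> * of_real \<delta>) powr of_real r = of_real (\<delta> powr r) * cis (r * pi / 2)" .
  have d': "of_real \<delta> powr of_real r = complex_of_real (\<delta> powr r)" using d by (simp add: powr_of_real)
  have cis: "cis ((real l + s) * pi / 2) * cis (r * pi / 2) = cis (real l * pi + pi / 2)"
    unfolding cis_mult by (rule arg_cong[of _ _ cis]) (simp add: r_def field_simps)
  define w where "w = D * of_real (\<delta> powr r / r)"
  have "P = sing_coeff s l * of_real (\<delta> powr r / r) - w * cis (real l * pi + pi / 2)"
    unfolding P_def int i d' w_def cis[symmetric] using r by (simp add: c field_simps)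
  moreover from this have "cnj P = cnj (sing_coeff s l) * of_real (\<delta> powr r / r) - w * cnj (cis (real l * pi + pi / 2))"
    using D by (simp add: w_def del: cis_cnj)
  ultimately have "P + cnj P = (sing_coeff s l + cnj (sing_coeff s l)) * of_real (\<delta> powr r / r)
     - w * (cis (real l * pi + pi / 2) + cnj (cis (real l * pi + pi / 2)))"
    by (simp only: ring_distribs) simp
  also have "cis (real l * pi + pi / 2) + cnj (cis (real l * pi + pi / 2)) = 0"
    by (simp add: complex_eq_iff cos_add)
  finally show ?thesis using False by (simp add: beta_coeff_eq_sing_coeff r_def)
qed

definition chord_integral :: "real \<Rightarrow> real \<Rightarrow> complex" where
  "chord_integral s \<delta> = contour_integral (linepath (\<i> * of_real \<delta>) (of_real \<delta>)) (root_power s)"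

text \<open>
The left edge in the Abel--Plana formula for the sum over \<open>j\<close> of \<open>root_power s (j / k)\<close>. The height
\<open>k / 4\<close> is \<open>1 / 4\<close> in the variable \<open>j / k\<close>: the edge stays within the reach of the expansion at \<open>0\<close>.
\<close>
definition edge_integral :: "real \<Rightarrow> nat \<Rightarrow> complex" where
  "edge_integral s k = ap_edge (\<lambda>y. root_power s (y / of_nat k)) (1 / 2) (real k / 4)"

text \<open>
The Abel--Plana formula for \<open>y \<mapsto> root_power s (y / k)\<close> between \<open>1 / 2\<close> and \<open>k - 1 / 2\<close>. By reflection the
right edge is minus the conjugate of the left one; the real integral is expressed by integrals over the chord from
\<open>\<i> / (2 * k)\<close> to \<open>1 / (2 * k)\<close>.
\<close>
lemma S_sum_abel_plana:
  obtains M where "M \<ge> 0"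
    "\<And>k. k \<ge> 2 \<Longrightarrow> norm (S_sum k s -
        (of_nat k * (1 - (chord_integral s (1 / (2 * real k)) + cnj (chord_integral s (1 / (2 * real k)))))
          + edge_integral s k + cnj (edge_integral s k)))
      \<le> 2 * M * (real k - 1) / (exp (2 * pi * (real k / 4)) - 1)"
proof -
  obtain M where M: "M \<ge> 0" "\<And>x. \<bar>Im x\<bar> = 1 / 4 \<Longrightarrow> norm (root_power s x) \<le> M"
    using root_power_bounded_on_lines[of s] by blast
  show thesis
  proof (rule that[OF M(1)])
    fix k :: nat assume k: "k \<ge> 2"
    hence k0: "real k > 0" by simp
    define g where "g = (\<lambda>y. root_power s (y / of_nat k))"
    define \<delta> where "\<delta> = 1 / (2 * real k)"
    have d: "0 < \<delta>" "\<delta> < 1 / 2" using k by (simp_all add: \<delta>_def field_simps)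
    have "(\<lambda>y. y / of_nat k) ` {z. 0 < Re z \<and> Re z < real k} \<subseteq> upper_strip"
      using k0 by (auto simp: upper_strip_def)
    hence "root_power s \<circ> (\<lambda>y. y / of_nat k) holomorphic_on {z. 0 < Re z \<and> Re z < real k}"
      using k0 by (intro holomorphic_on_compose holomorphic_on_subset[OF holomorphic_root_power] holomorphic_intros) auto
    hence hol: "g holomorphic_on {z. 0 < Re z \<and> Re z < real k}" by (simp add: g_def o_def)
    have sum: "(\<Sum>j = 1..<k. g (of_nat j)) = S_sum k s"
      by (simp add: S_sum_def g_def root_power_def)
    have line: "contour_integral (linepath (of_real (1 / 2)) (of_real (real k - 1 / 2))) g
       = of_nat k * (1 - (chord_integral s \<delta> + cnj (chord_integral s \<delta>)))"
    proof -
      have lp: "linepath (complex_of_real (1 / 2)) (of_real (real k - 1 / 2)) t / of_nat k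
           = linepath (of_real \<delta>) (of_real (1 - \<delta>)) t" for t
        using k0 by (simp add: linepath_def \<delta>_def scaleR_conv_of_real field_simps)
      have vd: "complex_of_real (real k - 1 / 2) - of_real (1 / 2) = of_nat k * (of_real (1 - \<delta>) - of_real \<delta>)"
        using k0 by (simp add: \<delta>_def field_simps)
      have "contour_integral (linepath (of_real (1 / 2)) (of_real (real k - 1 / 2))) g
         = integral {0..1} (\<lambda>t. of_nat k * (root_power s (linepath (of_real \<delta>) (of_real (1 - \<delta>)) t) * (of_real (1 - \<delta>) - of_real \<delta>)))"
        unfolding contour_integral_integral vector_derivative_linepath_at g_def lp vd by (simp only: mult_ac)
      also have "\<dots> = of_nat k * contour_integral (linepath (of_real \<delta>) (of_real (1 - \<delta>))) (root_power s)"
        unfolding contour_integral_integral vector_derivative_linepath_at by (rule integral_mult_right)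
      also have "contour_integral (linepath (of_real \<delta>) (of_real (1 - \<delta>))) (root_power s)
         = 1 - (chord_integral s \<delta> + cnj (chord_integral s \<delta>))"
        using root_power_integral[OF d, of s] by (simp only: chord_integral_def)
      finally show ?thesis .
    qed
    have refl: "g (Complex (real k - 1 / 2) u) = cnj (g (Complex (1 / 2) u))" for u
    proof -
      have "Complex (real k - 1 / 2) u / of_nat k = 1 - cnj (Complex (1 / 2) u / of_nat k)"
        using k0 by (simp add: complex_eq_iff diff_divide_distrib)
      moreover have "Complex (1 / 2) u / of_nat k \<in> upper_strip"
        using k by (auto simp: upper_strip_def field_simps)
      ultimately show ?thesis unfolding g_def by (simp only: root_power_reflect)
    qed
    have edge: "ap_edge g (real k - 1 / 2) T = - cnj (ap_edge g (1 / 2) T)" for T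
    proof -
      have "(\<lambda>t. of_real (ap_kernel t) * (g (Complex (real k - 1 / 2) (-t)) - g (Complex (real k - 1 / 2) t)))
         = (\<lambda>t. cnj (of_real (ap_kernel t) * (g (Complex (1 / 2) (-t)) - g (Complex (1 / 2) t))))"
        by (simp add: refl)
      thus ?thesis by (simp add: ap_edge_def integral_cnj[symmetric] del: complex_cnj_mult complex_cnj_diff) simp
    qed
    have "norm ((\<Sum>j = 1..<k. g (of_nat j)) -
           (contour_integral (linepath (of_real (1 / 2)) (of_real (real k - 1 / 2))) g
            + ap_edge g (1 / 2) (real k / 4) - ap_edge g (real k - 1 / 2) (real k / 4)))
         \<le> 2 * M * (real k - 1) / (exp (2 * pi * (real k / 4)) - 1)"
      by (rule abel_plana_midpoint[OF hol k]) (use k0 M(2) in \<open>auto simp: g_def\<close>)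
    thus "norm (S_sum k s -
        (of_nat k * (1 - (chord_integral s (1 / (2 * real k)) + cnj (chord_integral s (1 / (2 * real k)))))
          + edge_integral s k + cnj (edge_integral s k)))
      \<le> 2 * M * (real k - 1) / (exp (2 * pi * (real k / 4)) - 1)"
      unfolding sum line edge by (simp add: edge_integral_def g_def \<delta>_def)
  qed
qed

lemma powr_le_powr_max:
  fixes q :: real
  assumes "0 < d" "d / 2 \<le> x" "x \<le> d"
  shows "x powr q \<le> 2 powr \<bar>q\<bar> * d powr q"
proof (cases "q \<ge> 0")
  case True
  hence "x powr q \<le> 1 * d powr q" using assms by (simp add: powr_mono2)
  also have "\<dots> \<le> 2 powr \<bar>q\<bar> * d powr q" by (intro mult_right_mono) (auto intro: ge_one_powr_ge_zero)
  finally show ?thesis .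
next
  case False
  hence "x powr q \<le> (d / 2) powr q" using assms by (intro powr_mono2') auto
  also have "\<dots> = 2 powr (- q) * d powr q" using assms by (simp add: powr_divide powr_minus field_simps)
  finally show ?thesis using False by simp
qed

lemma chord_integral_expansion:
  obtains C where "C \<ge> 0" "\<And>\<delta>. 0 < \<delta> \<Longrightarrow> \<delta> \<le> 1 / 2 \<Longrightarrow>
     norm (chord_integral s \<delta> - (\<Sum>l\<le>N. sing_coeff s l *
        contour_integral (linepath (\<i> * of_real \<delta>) (of_real \<delta>)) (\<lambda>x. x powr of_real (real l - s))))
      \<le> C * \<delta> powr (real (Suc N) - s + 1)"
proof -
  define q where "q = real (Suc N) - s"
  obtain C where C: "C \<ge> 0" "\<And>x. 0 < Re x \<or> (0 \<le> Re x \<and> 0 < Im x) \<Longrightarrow> norm x \<le> 1 / 2 \<Longrightarrow>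
       norm (root_power s x - (\<Sum>l\<le>N. sing_coeff s l * x powr of_real (real l - s))) \<le> C * norm x powr q"
    unfolding q_def using root_power_expansion[where s = s and N = N] by blast
  show thesis
  proof
    show "C * 2 powr \<bar>q\<bar> * 2 \<ge> 0" using C by simp
    fix \<delta> :: real assume d: "0 < \<delta>" "\<delta> \<le> 1 / 2"
    let ?p = "linepath (\<i> * complex_of_real \<delta>) (of_real \<delta>)"
    let ?S = "closed_segment (\<i> * complex_of_real \<delta>) (of_real \<delta>)"
    have cf: "continuous_on ?S (root_power s)"
      by (rule continuous_on_root_power) (use chord_points(5)[OF d(1)] d in fastforce)
    have cp: "continuous_on ?S (\<lambda>x. x powr of_real (real l - s))" for l
      by (intro holomorphic_on_imp_continuous_on holomorphic_intros)
         (use chord_points(2)[OF d(1)] in auto)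
    have cs: "continuous_on ?S (\<lambda>x. \<Sum>l\<le>N. sing_coeff s l * x powr of_real (real l - s))"
      by (intro continuous_on_sum continuous_on_mult continuous_on_const cp)
    have "contour_integral ?p (\<lambda>x. root_power s x - (\<Sum>l\<le>N. sing_coeff s l * x powr of_real (real l - s)))
       = chord_integral s \<delta> - contour_integral ?p (\<lambda>x. \<Sum>l\<le>N. sing_coeff s l * x powr of_real (real l - s))"
      unfolding chord_integral_def
      by (rule contour_integral_diff) (intro contour_integrable_continuous_linepath cf cs)+
    also have "contour_integral ?p (\<lambda>x. \<Sum>l\<le>N. sing_coeff s l * x powr of_real (real l - s))
       = (\<Sum>l\<le>N. contour_integral ?p (\<lambda>x. sing_coeff s l * x powr of_real (real l - s)))"
      by (rule contour_integral_sum)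
         (intro finite_atMost contour_integrable_continuous_linepath continuous_on_mult continuous_on_const cp)+
    also have "\<dots> = (\<Sum>l\<le>N. sing_coeff s l * contour_integral ?p (\<lambda>x. x powr of_real (real l - s)))"
      by (intro sum.cong refl contour_integral_lmul contour_integrable_continuous_linepath cp)
    finally have eq: "chord_integral s \<delta> - (\<Sum>l\<le>N. sing_coeff s l * contour_integral ?p (\<lambda>x. x powr of_real (real l - s)))
       = contour_integral ?p (\<lambda>x. root_power s x - (\<Sum>l\<le>N. sing_coeff s l * x powr of_real (real l - s)))" ..
    have "norm (contour_integral ?p (\<lambda>x. root_power s x - (\<Sum>l\<le>N. sing_coeff s l * x powr of_real (real l - s))))
      \<le> C * (2 powr \<bar>q\<bar> * \<delta> powr q) * norm (of_real \<delta> - \<i> * of_real \<delta>)"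
    proof (rule contour_integral_bound_linepath)
      show "(\<lambda>x. root_power s x - (\<Sum>l\<le>N. sing_coeff s l * x powr of_real (real l - s))) contour_integrable_on ?p"
        by (intro contour_integrable_continuous_linepath continuous_on_diff cf cs)
      fix x assume x: "x \<in> ?S"
      note X = chord_points[OF d(1) x]
      have "norm (root_power s x - (\<Sum>l\<le>N. sing_coeff s l * x powr of_real (real l - s))) \<le> C * norm x powr q"
        using X d by (intro C(2)) auto
      also have "\<dots> \<le> C * (2 powr \<bar>q\<bar> * \<delta> powr q)"
        by (intro mult_left_mono powr_le_powr_max C(1) d X)
      finally show "norm (root_power s x - (\<Sum>l\<le>N. sing_coeff s l * x powr of_real (real l - s)))
        \<le> C * (2 powr \<bar>q\<bar> * \<delta> powr q)" .
    qed (use C in auto)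
    also have "\<dots> \<le> C * (2 powr \<bar>q\<bar> * \<delta> powr q) * (2 * \<delta>)"
      using norm_triangle_ineq4[of "complex_of_real \<delta>" "\<i> * of_real \<delta>"] d C
      by (intro mult_left_mono) (auto simp: norm_mult)
    also have "\<dots> = C * 2 powr \<bar>q\<bar> * 2 * \<delta> powr (q + 1)" using d by (simp add: powr_add)
    finally show "norm (chord_integral s \<delta> - (\<Sum>l\<le>N. sing_coeff s l * contour_integral ?p (\<lambda>x. x powr of_real (real l - s))))
      \<le> C * 2 powr \<bar>q\<bar> * 2 * \<delta> powr (real (Suc N) - s + 1)" unfolding eq q_def .
  qed
qed

lemma powr_of_real_mult:
  fixes y a :: complex
  assumes "r > 0" "y \<noteq> 0"
  shows "(of_real r * y) powr a = of_real r powr a * y powr a"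
  using Ln_times_of_real[OF assms] assms by (simp add: powr_def Ln_of_real distrib_left exp_add)

text \<open>
Under \<open>x = y / k\<close> the power \<open>x powr (l - s)\<close> becomes \<open>k powr (s - l)\<close> times \<open>y powr (l - s)\<close>, and the remainder of the
expansion gains the factor \<open>k powr (s - Suc N)\<close>; integrated against the kernel it stays bounded.
\<close>
lemma edge_integral_expansion:
  obtains C where "C \<ge> 0" "\<And>k. k \<ge> 2 \<Longrightarrow>
     norm (edge_integral s k - (\<Sum>l\<le>N. sing_coeff s l * of_real (real k powr (s - real l)) *
        ap_edge (\<lambda>y. y powr (- of_real (s - real l))) (1 / 2) (real k / 4)))
      \<le> C * real k powr (s - real (Suc N))"
proof -
  define q where "q = real (Suc N) - s"
  obtain C where C: "C \<ge> 0" "\<And>x. 0 < Re x \<or> (0 \<le> Re x \<and> 0 < Im x) \<Longrightarrow> norm x \<le> 1 / 2 \<Longrightarrow>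
       norm (root_power s x - (\<Sum>l\<le>N. sing_coeff s l * x powr of_real (real l - s))) \<le> C * norm x powr q"
    unfolding q_def using root_power_expansion[where s = s and N = N] by blast
  obtain M where M: "M \<ge> 0" "\<And>t a b. 0 \<le> t \<Longrightarrow> norm a \<le> \<bar>q\<bar> \<Longrightarrow> \<bar>b\<bar> = t \<Longrightarrow>
       ap_kernel t * norm (Complex (1 / 2) b powr a) \<le> M * exp (- t)"
    using ap_half_line_decay[of "\<bar>q\<bar>"] by auto
  show thesis
  proof
    show "2 * C * M \<ge> 0" using C M by simp
    fix k :: nat assume k: "k \<ge> 2"
    hence k0: "real k > 0" by simp
    define T where "T = real k / 4"
    have T: "T \<ge> 0" by (simp add: T_def)
    define c where "c = (\<lambda>l. sing_coeff s l * of_real (real k powr (s - real l)))"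
    define D where "D = (\<lambda>u. root_power s (Complex (1 / 2) u / of_nat k)
       - (\<Sum>l\<le>N. c l * Complex (1 / 2) u powr (- of_real (s - real l))))"
    have cont_f: "continuous_on A (\<lambda>t. root_power s (Complex (1 / 2) (h t) / of_nat k))"
      if "continuous_on A h" for A :: "real set" and h
      by (rule continuous_on_compose2[OF continuous_on_root_power[OF order_refl]])
         (use that k in \<open>auto simp: Complex_eq upper_strip_def field_simps intro!: continuous_intros\<close>)
    have cont_p: "continuous_on A (\<lambda>t. Complex (1 / 2) (h t) powr a)"
      if "continuous_on A h" for A :: "real set" and h a
      using that by (intro continuous_on_half_line_powr) auto
    have contD: "continuous_on A (\<lambda>t. D (h t))" if "continuous_on A h" for A :: "real set" and h
      unfolding D_def by (intro continuous_on_diff continuous_on_sum continuous_on_mult continuous_on_const cont_f cont_p that)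
    have D_le: "ap_kernel t * norm (D u) \<le> C * M * real k powr (- q) * exp (- t)"
      if t: "0 \<le> t" "t \<le> T" "\<bar>u\<bar> = t" for t u
    proof -
      define y where "y = Complex (1 / 2) u"
      have y0: "y \<noteq> 0" "Re y > 0" by (auto simp: y_def complex_eq_iff)
      have "norm y \<le> 1 / 2 + t" using cmod_le[of y] t by (simp add: y_def)
      also have "\<dots> \<le> real k / 2" using t k by (simp add: T_def)
      finally have ny: "norm (y / of_nat k) \<le> 1 / 2" using k0 by (simp add: norm_divide field_simps)
      have sc: "y / of_nat k = of_real (1 / real k) * y" by simp
      have "(y / of_nat k) powr of_real (real l - s) = of_real (real k powr (s - real l)) * y powr (- of_real (s - real l))" for l
      proof -
        have "(y / of_nat k) powr of_real (real l - s) = of_real (1 / real k) powr of_real (real l - s) * y powr of_real (real l - s)"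
          unfolding sc using k0 y0 by (intro powr_of_real_mult) auto
        also have "of_real (1 / real k) powr complex_of_real (real l - s) = of_real ((1 / real k) powr (real l - s))"
          using k0 by (subst powr_of_real) auto
        also have "(1 / real k) powr (real l - s) = real k powr (s - real l)"
          using k0 by (simp add: powr_divide flip: powr_minus_divide)
        also have "y powr complex_of_real (real l - s) = y powr (- of_real (s - real l))" by simp
        finally show ?thesis .
      qed
      hence "D u = root_power s (y / of_nat k) - (\<Sum>l\<le>N. sing_coeff s l * (y / of_nat k) powr of_real (real l - s))"
        by (simp only: D_def y_def[symmetric] c_def mult.assoc)
      also have "norm \<dots> \<le> C * norm (y / of_nat k) powr q"
        using y0 ny k0 by (intro C(2)) auto
      also have "norm (y / of_nat k) powr q = real k powr (- q) * norm (y powr of_real q)"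
        using k0 y0 by (simp add: norm_divide powr_divide powr_minus norm_powr_of_real field_simps)
      finally have "ap_kernel t * norm (D u) \<le> ap_kernel t * (C * (real k powr (- q) * norm (y powr of_real q)))"
        by (intro mult_left_mono ap_kernel_bounds)
      also have "\<dots> = C * real k powr (- q) * (ap_kernel t * norm (y powr of_real q))" by simp
      also have "\<dots> \<le> C * real k powr (- q) * (M * exp (- t))"
        unfolding y_def using t C by (intro mult_left_mono M(2)) auto
      finally show ?thesis by (simp add: mult_ac)
    qed
    have int: "(\<lambda>t. of_real (ap_kernel t) * (F (-t) - F t)) integrable_on {0..T}"
      if "\<And>(A :: real set) h. continuous_on A h \<Longrightarrow> continuous_on A (\<lambda>t. F (h t))" for F :: "real \<Rightarrow> complex"
      by (intro integrable_continuous_interval continuous_on_mult continuous_on_of_real continuous_on_ap_kernel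
            continuous_on_diff that[of "{0..T}" uminus] that[of "{0..T}" "\<lambda>t. t"] continuous_on_minus continuous_on_id)
    let ?P = "\<lambda>l t. of_real (ap_kernel t) * (Complex (1 / 2) (-t) powr (- of_real (s - real l)) - Complex (1 / 2) t powr (- of_real (s - real l)))"
    let ?F = "\<lambda>t. of_real (ap_kernel t) * (root_power s (Complex (1 / 2) (-t) / of_nat k) - root_power s (Complex (1 / 2) t / of_nat k))"
    have intP: "?P l integrable_on {0..T}" for l by (rule int) (rule cont_p)
    have intF: "?F integrable_on {0..T}" by (rule int[of "\<lambda>u. root_power s (Complex (1 / 2) u / of_nat k)"]) (rule cont_f)
    have "edge_integral s k - (\<Sum>l\<le>N. c l * ap_edge (\<lambda>y. y powr (- of_real (s - real l))) (1 / 2) T)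
       = \<i> * (integral {0..T} ?F - (\<Sum>l\<le>N. c l * integral {0..T} (?P l)))"
      unfolding edge_integral_def ap_edge_def T_def by (simp add: algebra_simps sum_distrib_left)
    also have "(\<Sum>l\<le>N. c l * integral {0..T} (?P l)) = integral {0..T} (\<lambda>t. \<Sum>l\<le>N. c l * ?P l t)"
      unfolding integral_mult_right[symmetric]
      by (rule integral_sum[symmetric]) (intro finite_atMost integrable_on_mult_right intP)+
    also have "integral {0..T} ?F - \<dots> = integral {0..T} (\<lambda>t. ?F t - (\<Sum>l\<le>N. c l * ?P l t))"
      by (intro Henstock_Kurzweil_Integration.integral_diff[symmetric] intF integrable_sum finite_atMost integrable_on_mult_right intP)
    also have "(\<lambda>t. ?F t - (\<Sum>l\<le>N. c l * ?P l t)) = (\<lambda>t. of_real (ap_kernel t) * (D (-t) - D t))"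
      by (simp add: D_def algebra_simps sum_distrib_left sum_subtractf)
    finally have eq: "edge_integral s k - (\<Sum>l\<le>N. c l * ap_edge (\<lambda>y. y powr (- of_real (s - real l))) (1 / 2) T)
       = \<i> * integral {0..T} (\<lambda>t. of_real (ap_kernel t) * (D (-t) - D t))" .
    have "norm (integral {0..T} (\<lambda>t. of_real (ap_kernel t) * (D (-t) - D t))) \<le> 2 * C * M * real k powr (- q)"
    proof (rule integral_le_exp_bound)
      show "continuous_on {0..T} (\<lambda>t. of_real (ap_kernel t) * (D (-t) - D t))"
        by (intro continuous_on_mult continuous_on_of_real continuous_on_ap_kernel
            continuous_on_diff contD continuous_on_minus continuous_on_id)
      fix t assume t: "0 \<le> t" "t \<le> T"
      have "norm (of_real (ap_kernel t) * (D (-t) - D t)) = ap_kernel t * norm (D (-t) - D t)"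
        by (simp add: norm_mult ap_kernel_bounds)
      also have "\<dots> \<le> ap_kernel t * (norm (D (-t)) + norm (D t))"
        by (intro mult_left_mono norm_triangle_ineq4 ap_kernel_bounds)
      also have "\<dots> \<le> 2 * C * M * real k powr (- q) * exp (- t)"
        using D_le[OF t, of t] D_le[OF t, of "-t"] t by (simp add: algebra_simps)
      finally show "norm (of_real (ap_kernel t) * (D (-t) - D t)) \<le> 2 * C * M * real k powr (- q) * exp (- t)" .
    qed (use C M T in auto)
    thus "norm (edge_integral s k - (\<Sum>l\<le>N. sing_coeff s l * of_real (real k powr (s - real l)) *
        ap_edge (\<lambda>y. y powr (- of_real (s - real l))) (1 / 2) (real k / 4)))
      \<le> 2 * C * M * real k powr (s - real (Suc N))"
      using eq by (simp add: c_def T_def q_def norm_mult)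
  qed
qed

lemma zeta_edge_real: "cnj (zeta_edge (of_real a)) = zeta_edge (of_real a)"
proof -
  let ?h = "\<lambda>t. of_real (ap_kernel t) * (Complex (1 / 2) (-t) powr (- of_real a) - Complex (1 / 2) t powr (- of_real a))"
  have "cnj (Complex (1 / 2) t powr (- of_real a)) = Complex (1 / 2) (-t) powr (- of_real a)" for t :: real
  proof -
    have "cnj (Complex (1 / 2) t) = Complex (1 / 2) (-t)" by (simp add: complex_eq_iff)
    thus ?thesis by (subst cnj_powr) auto
  qed
  hence "(\<lambda>t. cnj (?h t)) = (\<lambda>t. - ?h t)" by (simp add: algebra_simps)
  hence "cnj (integral {0..} ?h) = - integral {0..} ?h" by (simp only: integral_cnj integral_neg)
  thus ?thesis unfolding zeta_edge_def by simp
qed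

section \<open>The asymptotic expansion\<close>

text \<open>
Assembly of the main terms. For \<open>a = s - l \<noteq> 1\<close> the chord contributes the part
\<open>(1 / 2) powr (1 - a) / (a - 1)\<close> of \<open>zeta a\<close> and the edge contributes \<open>zeta_edge a\<close>. For \<open>s - l = 1\<close> the
coefficient \<open>beta_coeff l s\<close> vanishes and the chord contributes \<open>-k/2\<close>.
\<close>
lemma S_sum_leading_terms:
  fixes s :: real and N k :: nat
  assumes k: "k \<ge> 1"
  defines "X \<equiv> (\<Sum>l\<le>N. sing_coeff s l *
      contour_integral (linepath (\<i> * of_real (1 / (2 * real k))) (of_real (1 / (2 * real k)))) (\<lambda>x. x powr of_real (real l - s)))"
    and "Y \<equiv> (\<Sum>l\<le>N. sing_coeff s l * of_real (real k powr (s - real l)) * zeta_edge (of_real (s - real l)))"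
  shows "of_nat k * (1 - (X + cnj X)) + Y + cnj Y =
      (if \<exists>l\<le>N. s = real l + 1 then 1 / 2 else 1) * of_nat k
      + 2 * (\<Sum>l \<in> {l \<in> {0..N}. real l \<noteq> s - 1}.
            beta_coeff l s * zeta (of_real (s - real l)) * of_real (real k powr (s - real l)))"
proof -
  have k0: "real k > 0" using k by simp
  define \<delta> where "\<delta> = 1 / (2 * real k)"
  have d: "\<delta> > 0" using k0 by (simp add: \<delta>_def)
  define z where "z = (\<lambda>l. 2 * (beta_coeff l s * zeta (of_real (s - real l)) * of_real (real k powr (s - real l))))"
  have X: "X + cnj X = (\<Sum>l\<le>N. if s = real l + 1 then 1 / 2
     else 2 * beta_coeff l s * of_real (\<delta> powr (real l - s + 1) / (real l - s + 1)))"
    unfolding X_def \<delta>_def[symmetric] cnj_sum sum.distrib[symmetric]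
    by (intro sum.cong refl sing_coeff_chord_integral d)
  have Y: "Y + cnj Y = (\<Sum>l\<le>N. 2 * beta_coeff l s * of_real (real k powr (s - real l)) * zeta_edge (of_real (s - real l)))"
    unfolding Y_def cnj_sum sum.distrib[symmetric]
    by (intro sum.cong refl) (simp only: beta_coeff_eq_sing_coeff complex_cnj_mult complex_cnj_complex_of_real zeta_edge_real distrib_right)
  have summand: "2 * beta_coeff l s * of_real (real k powr (s - real l)) * zeta_edge (of_real (s - real l))
     - of_nat k * (if s = real l + 1 then 1 / 2 else 2 * beta_coeff l s * of_real (\<delta> powr (real l - s + 1) / (real l - s + 1)))
     = (if real l \<noteq> s - 1 then z l else - (1 / 2 * of_nat k))" for l
  proof (cases "s = real l + 1")
    case True
    hence "s = real (Suc l)" by simp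
    hence "2 * beta_coeff l s = 0"
      unfolding beta_coeff_eq_sing_coeff by (simp only: sing_coeff_residue) simp
    thus ?thesis using True by simp
  next
    case False
    define a where "a = s - real l"
    have a1: "a \<noteq> 1" using False by (simp add: a_def)
    hence "complex_of_real a \<noteq> 1" by (simp add: complex_eq_iff)
    hence "zeta (of_real a) = (1 / 2) powr (1 - of_real a) / (of_real a - 1) + zeta_edge (of_real a)"
      by (rule zeta_abel_plana)
    also have "(1 / 2 :: complex) powr (1 - of_real a) = of_real ((1 / 2) powr (1 - a))"
      using powr_of_real[of "1/2" "1 - a"] by simp
    also have "of_real ((1 / 2) powr (1 - a)) / (of_real a - 1 :: complex) = of_real ((1 / 2) powr (1 - a) / (a - 1))"
      by simp
    finally have ze: "zeta_edge (of_real a) = zeta (of_real a) - of_real ((1 / 2) powr (1 - a) / (a - 1))" by simp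
    have "real k * (\<delta> powr (1 - a) / (1 - a)) = - (real k powr a * ((1 / 2) powr (1 - a) / (a - 1)))"
    proof -
      have "\<delta> powr (1 - a) = (1 / 2) powr (1 - a) * (real k powr (a - 1))"
      proof -
        have "\<delta> = (1 / 2) * (1 / real k)" by (simp add: \<delta>_def)
        hence "\<delta> powr (1 - a) = (1 / 2) powr (1 - a) * (1 / real k) powr (1 - a)"
          using k0 by (simp only: powr_mult)
        also have "(1 / real k) powr (1 - a) = real k powr (a - 1)"
          using k0 by (simp add: powr_divide flip: powr_minus_divide)
        finally show ?thesis .
      qed
      moreover have "real k * real k powr (a - 1) = real k powr a"
        using k0 by (simp add: powr_diff)
      ultimately have "real k * (\<delta> powr (1 - a) / (1 - a)) = real k powr a * (1 / 2) powr (1 - a) / (1 - a)"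
        by (simp add: mult_ac)
      also have "\<dots> = - (real k powr a * ((1 / 2) powr (1 - a) / (a - 1)))"
        using a1 by (simp add: field_simps)
      finally show ?thesis .
    qed
    hence "complex_of_real (real k * (\<delta> powr (1 - a) / (1 - a))) = of_real (- (real k powr a * ((1 / 2) powr (1 - a) / (a - 1))))"
      by (simp only:)
    hence kd: "of_nat k * complex_of_real (\<delta> powr (1 - a) / (1 - a)) = - (of_real (real k powr a) * of_real ((1 / 2) powr (1 - a) / (a - 1)))"
      by (simp only: of_real_mult of_real_minus of_real_of_nat_eq)
    have "real l - s + 1 = 1 - a" by (simp add: a_def)
    hence "2 * beta_coeff l s * of_real (real k powr a) * zeta_edge (of_real a)
       - of_nat k * (2 * beta_coeff l s * of_real (\<delta> powr (real l - s + 1) / (real l - s + 1)))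
       = 2 * beta_coeff l s * of_real (real k powr a) * zeta_edge (of_real a)
       - 2 * beta_coeff l s * (of_nat k * of_real (\<delta> powr (1 - a) / (1 - a)))" by (simp only: mult_ac)
    also have "\<dots> = z l" unfolding kd ze by (simp only: z_def a_def[symmetric]) (simp add: algebra_simps)
    finally show ?thesis using False by (simp add: a_def)
  qed
  have "of_nat k * (1 - (X + cnj X)) + Y + cnj Y = of_nat k + ((Y + cnj Y) - of_nat k * (X + cnj X))"
    by (simp add: algebra_simps)
  also have "\<dots> = of_nat k + (\<Sum>l\<le>N. if real l \<noteq> s - 1 then z l else - (1 / 2 * of_nat k))"
    unfolding X Y by (simp only: sum_distrib_left sum_subtractf[symmetric] summand)
  also have "(\<Sum>l\<le>N. if real l \<noteq> s - 1 then z l else - (1 / 2 * of_nat k))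
     = (\<Sum>l \<in> {l \<in> {0..N}. real l \<noteq> s - 1}. z l) + (\<Sum>l \<in> {l \<in> {0..N}. real l = s - 1}. - (1 / 2 * of_nat k))"
    by (subst sum.If_cases) (auto simp: atMost_atLeast0 Int_def intro!: arg_cong2[of _ _ _ _ "(+)"] sum.cong)
  also have "(\<Sum>l \<in> {l \<in> {0..N}. real l = s - 1}. - (1 / 2 * of_nat k))
     = (if \<exists>l\<le>N. s = real l + 1 then - (1 / 2) else 0) * (of_nat k :: complex)"
  proof (cases "\<exists>l\<le>N. s = real l + 1")
    case True
    then obtain l where "l \<le> N" "s = real l + 1" by auto
    hence "{l \<in> {0..N}. real l = s - 1} = {l}" by auto
    thus ?thesis using True by simp
  next
    case False
    have "{l \<in> {0..N}. real l = s - 1} = {}"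
    proof (rule equals0I)
      fix l assume "l \<in> {l \<in> {0..N}. real l = s - 1}"
      hence "l \<le> N" "s = real l + 1" by auto
      thus False using False by blast
    qed
    thus ?thesis using False by (simp only: if_False sum.empty) simp
  qed
  also have "of_nat k + ((\<Sum>l \<in> {l \<in> {0..N}. real l \<noteq> s - 1}. z l)
        + (if \<exists>l\<le>N. s = real l + 1 then - (1 / 2) else 0) * of_nat k)
     = (if \<exists>l\<le>N. s = real l + 1 then 1 / 2 else 1) * of_nat k + (\<Sum>l \<in> {l \<in> {0..N}. real l \<noteq> s - 1}. z l)"
    by (cases "\<exists>l\<le>N. s = real l + 1") (simp_all only: if_True if_False, simp_all)
  finally show ?thesis unfolding z_def sum_distrib_left .
qed

text \<open>
Replacing the chord and edge integrals by their expansions costs \<open>O(k powr (s - N - 1))\<close>; all other errors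
(horizontal edges, truncation of \<open>zeta_edge\<close> at height \<open>k / 4\<close>) are exponentially small. The case
distinction asks whether the power \<open>x powr (-1)\<close> is among the terms that are kept.
\<close>
theorem S_sum_asymptotics:
  fixes s :: real and N :: nat
  shows "(\<lambda>k. S_sum k s - ((if \<exists>l\<le>N. s = real l + 1 then 1 / 2 else 1) * of_nat k
      + 2 * (\<Sum>l \<in> {l \<in> {0..N}. real l \<noteq> s - 1}.
            beta_coeff l s * zeta (of_real (s - real l)) * of_real (real k powr (s - real l)))))
     \<in> O(\<lambda>k. of_real (real k powr (s - real N - 1)))"
proof -
  define P where "P = (\<lambda>l k. contour_integral (linepath (\<i> * of_real (1 / (2 * real k))) (of_real (1 / (2 * real k)))) (\<lambda>x. x powr of_real (real l - s)))"
  define A where "A = (\<lambda>l k. ap_edge (\<lambda>y. y powr (- of_real (s - real l))) (1 / 2) (real k / 4))"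
  define c where "c = (\<lambda>l k. sing_coeff s l * of_real (real k powr (s - real l)))"
  define main where "main = (\<lambda>k. (if \<exists>l\<le>N. s = real l + 1 then 1 / 2 else 1) * of_nat k
      + 2 * (\<Sum>l \<in> {l \<in> {0..N}. real l \<noteq> s - 1}.
            beta_coeff l s * zeta (of_real (s - real l)) * of_real (real k powr (s - real l))))"
  define X where "X = (\<lambda>k. chord_integral s (1 / (2 * real k)))"
  define X' where "X' = (\<lambda>k::nat. \<Sum>l\<le>N. sing_coeff s l * P l k)"
  define Y where "Y = edge_integral s"
  define Y' where "Y' = (\<lambda>k. \<Sum>l\<le>N. c l k * zeta_edge (of_real (s - real l)))"
  have main: "main k = of_nat k * (1 - (X' k + cnj (X' k))) + Y' k + cnj (Y' k)" if "k \<ge> 1" for k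
    using S_sum_leading_terms[OF that, where N = N and s = s] unfolding main_def X'_def Y'_def P_def c_def by (simp only:)
  obtain M where M: "M \<ge> 0" "\<And>k. k \<ge> 2 \<Longrightarrow> norm (S_sum k s - (of_nat k * (1 - (X k + cnj (X k))) + Y k + cnj (Y k)))
      \<le> 2 * M * (real k - 1) / (exp (2 * pi * (real k / 4)) - 1)"
    unfolding X_def Y_def using S_sum_abel_plana[of s] by blast
  obtain C1 where C1: "C1 \<ge> 0" "\<And>\<delta>. 0 < \<delta> \<Longrightarrow> \<delta> \<le> 1 / 2 \<Longrightarrow>
     norm (chord_integral s \<delta> - (\<Sum>l\<le>N. sing_coeff s l *
        contour_integral (linepath (\<i> * of_real \<delta>) (of_real \<delta>)) (\<lambda>x. x powr of_real (real l - s))))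
      \<le> C1 * \<delta> powr (real (Suc N) - s + 1)"
    using chord_integral_expansion[of s N] by blast
  obtain C2 where C2: "C2 \<ge> 0" "\<And>k. k \<ge> 2 \<Longrightarrow> norm (Y k - (\<Sum>l\<le>N. c l k * A l k)) \<le> C2 * real k powr (s - real (Suc N))"
    unfolding Y_def c_def A_def using edge_integral_expansion[of s N] by blast
  obtain M' where M': "M' \<ge> 0" "\<And>a T. norm a \<le> \<bar>s\<bar> + real N \<Longrightarrow> 0 \<le> T \<Longrightarrow>
       norm (zeta_edge a - ap_edge (\<lambda>y. y powr (-a)) (1 / 2) T) \<le> M' * exp (- T)"
    using ap_edge_powr_tendsto[of "\<bar>s\<bar> + real N"] by auto
  define e where "e = s - real N - 1"
  define B where "B = (\<lambda>k. 2 * M * (real k - 1) / (exp (2 * pi * (real k / 4)) - 1)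
      + real k * (2 * (C1 * (1 / (2 * real k)) powr (1 - e)))
      + 2 * (C2 * real k powr e + (\<Sum>l\<le>N. norm (sing_coeff s l) * real k powr (s - real l) * (M' * exp (- (real k / 4))))))"
  have le: "norm (S_sum k s - main k) \<le> B k" if k: "k \<ge> 2" for k
  proof -
    have X: "norm (X k - X' k) \<le> C1 * (1 / (2 * real k)) powr (1 - e)"
    proof -
      \<comment> \<open>The chord has length of order \<open>1 / k\<close>, which makes up for the factor \<open>k\<close> in front of it.\<close>
      have e: "1 - e = real (Suc N) - s + 1" by (simp add: e_def)
      show ?thesis unfolding X_def X'_def P_def e by (rule C1(2)) (use k in auto)
    qed
    have "norm (Y k - Y' k) = norm ((Y k - (\<Sum>l\<le>N. c l k * A l k)) + (\<Sum>l\<le>N. c l k * (A l k - zeta_edge (of_real (s - real l)))))"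
      by (simp add: Y'_def right_diff_distrib sum_subtractf)
    also have "\<dots> \<le> C2 * real k powr e + (\<Sum>l\<le>N. norm (sing_coeff s l) * real k powr (s - real l) * (M' * exp (- (real k / 4))))"
    proof (rule norm_triangle_le[OF add_mono])
      show "norm (Y k - (\<Sum>l\<le>N. c l k * A l k)) \<le> C2 * real k powr e"
        using C2(2)[OF k] by (simp add: e_def algebra_simps)
      show "norm (\<Sum>l\<le>N. c l k * (A l k - zeta_edge (of_real (s - real l))))
        \<le> (\<Sum>l\<le>N. norm (sing_coeff s l) * real k powr (s - real l) * (M' * exp (- (real k / 4))))"
      proof (rule sum_norm_le)
        fix l assume "l \<in> {..N}"
        hence "norm (complex_of_real (s - real l)) \<le> \<bar>s\<bar> + real N"
          unfolding norm_of_real by auto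
        hence "norm (zeta_edge (of_real (s - real l)) - A l k) \<le> M' * exp (- (real k / 4))"
          unfolding A_def by (rule M'(2)) simp
        thus "norm (c l k * (A l k - zeta_edge (of_real (s - real l))))
          \<le> norm (sing_coeff s l) * real k powr (s - real l) * (M' * exp (- (real k / 4)))"
          unfolding norm_mult c_def by (intro mult_mono) (auto simp: norm_minus_commute)
      qed
    qed
    finally have Y: "norm (Y k - Y' k) \<le> C2 * real k powr e + (\<Sum>l\<le>N. norm (sing_coeff s l) * real k powr (s - real l) * (M' * exp (- (real k / 4))))" .
    have tw: "norm (w + cnj w) \<le> 2 * r" if "norm w \<le> r" for w r
      using norm_triangle_ineq[of w "cnj w"] that by simp
    have "S_sum k s - main k = (S_sum k s - (of_nat k * (1 - (X k + cnj (X k))) + Y k + cnj (Y k)))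
       + of_nat k * - ((X k - X' k) + cnj (X k - X' k)) + ((Y k - Y' k) + cnj (Y k - Y' k))"
      using k by (subst main) (auto simp: algebra_simps)
    also have "norm \<dots> \<le> B k"
      unfolding B_def
    proof (intro norm_triangle_le[OF add_mono])
      show "norm (of_nat k * - ((X k - X' k) + cnj (X k - X' k))) \<le> real k * (2 * (C1 * (1 / (2 * real k)) powr (1 - e)))"
        unfolding norm_mult norm_minus_cancel norm_of_nat by (intro mult_left_mono tw X) auto
    qed (intro M(2) k tw Y)+
    finally show ?thesis .
  qed
  have B: "B \<in> O(\<lambda>k. real k powr e)"
    unfolding B_def
  proof (intro sum_in_bigo landau_o.big.mult_left)
    show "(\<lambda>k. 2 * M * (real k - 1) / (exp (2 * pi * (real k / 4)) - 1)) \<in> O(\<lambda>k. real k powr e)"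
      using M(1) by real_asymp
    show "(\<lambda>k. real k * (2 * (C1 * (1 / (2 * real k)) powr (1 - e)))) \<in> O(\<lambda>k. real k powr e)"
      using C1(1) by real_asymp
    have "(\<lambda>k. C2 * real k powr e + (\<Sum>l\<le>N. norm (sing_coeff s l) * real k powr (s - real l) * (M' * exp (- (real k / 4)))))
       \<in> O(\<lambda>k. real k powr e)"
    proof (intro sum_in_bigo big_sum_in_bigo)
      fix l
      have "(\<lambda>k. real k powr (s - real l) * exp (- (real k / 4))) \<in> O(\<lambda>k. real k powr e)" by real_asymp
      hence "(\<lambda>k. (norm (sing_coeff s l) * M') * (real k powr (s - real l) * exp (- (real k / 4)))) \<in> O(\<lambda>k. real k powr e)"
        by (cases "norm (sing_coeff s l) * M' = 0") (simp_all del: mult_eq_0_iff)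
      thus "(\<lambda>k. norm (sing_coeff s l) * real k powr (s - real l) * (M' * exp (- (real k / 4)))) \<in> O(\<lambda>k. real k powr e)"
        by (simp only: mult_ac)
    qed auto
    thus "(\<lambda>k. 2 * (C2 * real k powr e + (\<Sum>l\<le>N. norm (sing_coeff s l) * real k powr (s - real l) * (M' * exp (- (real k / 4))))))
       \<in> O(\<lambda>k. real k powr e)" by (subst landau_o.big.cmult_in_iff) simp_all
  qed
  have "(\<lambda>k. S_sum k s - main k) \<in> O(\<lambda>k. of_real (B k))"
  proof (rule landau_o.big_mono)
    show "\<forall>\<^sub>F k in sequentially. norm (S_sum k s - main k) \<le> norm (complex_of_real (B k))"
      using eventually_ge_at_top[of 2] by eventually_elim (use le in \<open>force intro: order_trans\<close>)
  qed
  also have "(\<lambda>k. complex_of_real (B k)) \<in> O(\<lambda>k. of_real (real k powr e))"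
    using B by (simp only: landau_o.big.of_real_iff)
  finally show ?thesis unfolding main_def e_def .
qed

text \<open>
If \<open>s\<close> is an integer greater than \<open>2 * p + 1\<close>, the truncated expansion does not reach the power \<open>x powr (-1)\<close> and
its main term is \<open>k\<close>; then the exponent of the error term is at least \<open>1\<close>, and replacing \<open>k\<close> by \<open>k / 2\<close> does not
matter.
\<close>
theorem theorem4p1:
  fixes s :: real and p :: nat
  assumes "s + 2 * real p > 0"
  shows "(s \<notin> \<nat> - {0} \<longrightarrow>
      (\<lambda>k::nat. S_sum k s -
         (of_nat k + 2 * (\<Sum>l = 0..2 * p.
            beta_coeff l s * zeta (of_real (s - real l)) * of_real (real k powr (s - real l)))))
        \<in> O(\<lambda>k. of_real (real k powr (s - 2 * real p - 1)))) \<and>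
    (s \<in> \<nat> - {0} \<longrightarrow>
      (\<lambda>k::nat. S_sum k s -
         (1 / 2 * of_nat k + 2 * (\<Sum>l \<in> {l \<in> {0..2 * p}. real l \<noteq> s - 1}.
            beta_coeff l s * zeta (of_real (s - real l)) * of_real (real k powr (s - real l)))))
        \<in> O(\<lambda>k. of_real (real k powr (s - 2 * real p - 1))))"
proof (intro conjI impI)
  let ?z = "\<lambda>k l. beta_coeff l s * zeta (of_real (s - real l)) * of_real (real k powr (s - real l))"
  have rp: "s - real (2 * p) - 1 = s - 2 * real p - 1" by simp
  note asymp = S_sum_asymptotics[of s "2 * p", unfolded rp]
  {
    assume s: "s \<notin> \<nat> - {0}"
    have ne: "s \<noteq> real l + 1" for l
    proof
      assume "s = real l + 1"
      hence "s = real (Suc l)" by simp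
      moreover have "real (Suc l) \<in> \<nat>" by (rule of_nat_in_Nats)
      ultimately show False using s by simp
    qed
    hence 1: "\<not> (\<exists>l\<le>2 * p. s = real l + 1)" and 2: "{l \<in> {0..2 * p}. real l \<noteq> s - 1} = {0..2 * p}"
      by (auto simp: algebra_simps)
    show "(\<lambda>k::nat. S_sum k s - (of_nat k + 2 * (\<Sum>l = 0..2 * p. ?z k l)))
        \<in> O(\<lambda>k. of_real (real k powr (s - 2 * real p - 1)))"
      using asymp 1 by (simp only: if_False 2 mult_1_left)
  next
    assume "s \<in> \<nat> - {0}"
    then obtain n where n: "s = real (Suc n)" by (metis DiffE Nats_cases of_nat_0 old.nat.exhaust singletonI)
    show "(\<lambda>k::nat. S_sum k s - (1 / 2 * of_nat k + 2 * (\<Sum>l \<in> {l \<in> {0..2 * p}. real l \<noteq> s - 1}. ?z k l)))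
        \<in> O(\<lambda>k. of_real (real k powr (s - 2 * real p - 1)))" (is "?f \<in> ?O")
    proof (cases "n \<le> 2 * p")
      case True
      hence "\<exists>l\<le>2 * p. s = real l + 1" using n by (intro exI[of _ n]) simp
      thus ?thesis using asymp by (simp only: if_True)
    next
      case False
      hence "\<not> (\<exists>l\<le>2 * p. s = real l + 1)" using n by auto
      hence "(\<lambda>k::nat. S_sum k s - (1 * of_nat k + 2 * (\<Sum>l \<in> {l \<in> {0..2 * p}. real l \<noteq> s - 1}. ?z k l))) \<in> ?O"
        using asymp by (simp only: if_False)
      moreover have "(\<lambda>k::nat. complex_of_real (1 / 2 * real k)) \<in> ?O"
      proof -
        have "1 \<le> s - 2 * real p - 1"
        proof -
          have "real (2 * p + 1) \<le> real n" using False by (intro of_nat_mono) simp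
          thus ?thesis using n by simp
        qed
        hence "(\<lambda>k::nat. 1 / 2 * real k) \<in> O(\<lambda>k. real k powr (s - 2 * real p - 1))"
        proof (intro bigoI[where c = 1] eventually_mono[OF eventually_ge_at_top[of 1]])
          fix k :: nat assume k: "1 \<le> k"
          assume e: "1 \<le> s - 2 * real p - 1"
          have "real k powr 1 \<le> real k powr (s - 2 * real p - 1)" using k e by (intro powr_mono) auto
          thus "norm (1 / 2 * real k) \<le> 1 * norm (real k powr (s - 2 * real p - 1))" using k by simp
        qed
        thus ?thesis by (simp only: landau_o.big.of_real_iff)
      qed
      ultimately have "(\<lambda>k::nat. S_sum k s - (1 * of_nat k + 2 * (\<Sum>l \<in> {l \<in> {0..2 * p}. real l \<noteq> s - 1}. ?z k l))
          + complex_of_real (1 / 2 * real k)) \<in> ?O"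
        by (rule sum_in_bigo)
      moreover have "(\<lambda>k::nat. S_sum k s - (1 * of_nat k + 2 * (\<Sum>l \<in> {l \<in> {0..2 * p}. real l \<noteq> s - 1}. ?z k l))
          + complex_of_real (1 / 2 * real k)) = ?f"
        by (simp add: algebra_simps)
      ultimately show ?thesis by (simp only:)
    qed
  }
qed

end
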